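(* Let $d\ge 1$. Assume that $\chi\in\mathcal S(\mathbb R^d)$ with $\chi(0)=0$ and $\mathrm{supp}\,\hat\chi(\xi)\subset\{\xi\in\mathbb R^d:\ 4/3\le|\xi|\le 3/2\}$. Define $$f_n(x)=\Gamma_n\sum_{k=1}^{n}\frac1k\,\chi(2^kx)\qquad\text{with}\qquad \Gamma_n=\frac{1}{\ln\ln n}.$$ Then for $p\in[1,\infty]$, $$\|f_n\|_{B^{d/p}_{p,1}(\mathbb R^d)}\approx \Gamma_n\ln n\qquad\text{and}\qquad \|f_n\|_{L^\infty(\mathbb R^d)}\le C\,\Gamma_n.$$
   Context: $\mathcal S(\mathbb R^d)$ is the Schwartz space. $A\lesssim B$ means $A\le CB$ for a uniform positive constant $C$ independent of $A$ and $B$ (so here independent of $n$), and $A\approx B$ means $A\lesssim B$ and $B\lesssim A$; the constant $C$ in the $L^\infty$ bound is likewise independent of $n$. Fourier transform: $\hat u(\xi)=\mathcal Fu(\xi)=(2\pi)^{-d/2}\int_{\mathbb R^d}e^{-\mathrm i x\cdot\xi}u(x)\,dx$. Nonhomogeneous Besov spaces: fix a radial, non-negative, smooth $\vartheta:\mathbb R^d\to[0,1]$ with $\vartheta(\xi)=1$ for $|\xi|\le 3/4$ and $\vartheta(\xi)=0$ for $|\xi|\ge 4/3$, and set $\phi(\xi)=\vartheta(\xi/2)-\vartheta(\xi)$ (so $\mathrm{supp}\,\phi\subset\{3/4\le|\xi|\le 8/3\}$ and $\phi\equiv1$ on $\{4/3\le|\xi|\le3/2\}$). For a tempered distribution $u$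 put $\Delta_{-1}u=\mathcal F^{-1}(\vartheta\hat u)$ and $\Delta_ju=\mathcal F^{-1}(\phi(2^{-j}\cdot)\hat u)$ for $j\ge0$. For $s\in\mathbb R$ and $(p,r)\in[1,\infty]^2$, $\|f\|_{B^s_{p,r}}=\big\|\,(2^{js}\|\Delta_jf\|_{L^p})_{j\ge-1}\big\|_{\ell^r}$, and $B^s_{p,r}$ is the set of tempered distributions for which this is finite. For $p=\infty$, $d/p$ is read as $0$.
   Formalization: χ is assumed not identically zero (for χ = 0 the lower bound in ≈ fails), and n ranges over n ≥ 3, since ln ln n is undefined at n = 1 and negative at n = 2. *)

theory Defs
  imports "HOL-Analysis.Analysis" "HOL-Probability.Essential_Supremum"
begin

section \<open>Schwartz functions and tempered distributions\<close>

text \<open>\<open>iter_partial [b\<^sub>1, \<dots>, b\<^sub>m] f\<close> is the iterated partial derivative of \<open>f\<close> in the directions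
  \<open>b\<^sub>m\<close>, \dots, \<open>b\<^sub>1\<close>; lists over \<open>Basis\<close> play the role of multi-indices.\<close>

fun iter_partial :: "'a::euclidean_space list \<Rightarrow> ('a \<Rightarrow> 'b::real_normed_vector) \<Rightarrow> 'a \<Rightarrow> 'b" where
  "iter_partial [] f = f"
| "iter_partial (b # bs) f = (\<lambda>x. frechet_derivative (iter_partial bs f) (at x) b)"

text \<open>Differentiability of every iterated partial derivative also gives their continuity, so this is
  \<open>C\<^sup>\<infinity>\<close>; it also ensures that \<^const>\<open>frechet_derivative\<close> above is never applied to a function
  without a derivative.\<close>

definition smooth :: "('a::euclidean_space \<Rightarrow> 'b::real_normed_vector) \<Rightarrow> bool" where
  "smooth f \<longleftrightarrow> (\<forall>bs\<in>lists Basis. \<forall>x. iter_partial bs f differentiable (at x))"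

definition schwartz :: "('a::euclidean_space \<Rightarrow> complex) \<Rightarrow> bool" where
  "schwartz f \<longleftrightarrow> smooth f \<and>
     (\<forall>k::nat. \<forall>bs\<in>lists Basis. bounded (range (\<lambda>x. norm x ^ k *\<^sub>R iter_partial bs f x)))"

definition schwartz_seminorm :: "nat \<Rightarrow> ('a::euclidean_space \<Rightarrow> complex) \<Rightarrow> real" where
  "schwartz_seminorm N f =
     (\<Sum>k\<le>N. \<Sum>bs\<in>{bs \<in> lists Basis. length bs \<le> N}. SUP x. norm x ^ k * norm (iter_partial bs f x))"

text \<open>A distribution is a functional on functions of which only the values at Schwartz functions
  matter.\<close>

type_synonym 'a functional = "('a \<Rightarrow> complex) \<Rightarrow> complex"

definition tempered_distribution :: "'a::euclidean_space functional \<Rightarrow> bool" where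
  "tempered_distribution T \<longleftrightarrow>
     (\<forall>f g. schwartz f \<longrightarrow> schwartz g \<longrightarrow> T (\<lambda>x. f x + g x) = T f + T g) \<and>
     (\<forall>c f. schwartz f \<longrightarrow> T (\<lambda>x. c * f x) = c * T f) \<and>
     (\<exists>C N. \<forall>f. schwartz f \<longrightarrow> norm (T f) \<le> C * schwartz_seminorm N f)"

definition dist_of :: "('a::euclidean_space \<Rightarrow> complex) \<Rightarrow> 'a functional" where
  "dist_of f = (\<lambda>\<psi>. LINT x|lborel. f x * \<psi> x)"

definition represents :: "('a::euclidean_space \<Rightarrow> complex) \<Rightarrow> 'a functional \<Rightarrow> bool" where
  "represents g T \<longleftrightarrow> g \<in> borel_measurable lborel \<and>
     (\<forall>\<psi>. schwartz \<psi> \<longrightarrow> integrable lborel (\<lambda>x. g x * \<psi> x) \<and> T \<psi> = dist_of g \<psi>)"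


section \<open>Fourier transform\<close>

definition fourier :: "('a::euclidean_space \<Rightarrow> complex) \<Rightarrow> 'a \<Rightarrow> complex" where
  "fourier u \<xi> = of_real ((2 * pi) powr (- real DIM('a) / 2)) *
     (LINT x|lborel. exp (- \<i> * of_real (x \<bullet> \<xi>)) * u x)"

definition inv_fourier :: "('a::euclidean_space \<Rightarrow> complex) \<Rightarrow> 'a \<Rightarrow> complex" where
  "inv_fourier u x = of_real ((2 * pi) powr (- real DIM('a) / 2)) *
     (LINT \<xi>|lborel. exp (\<i> * of_real (x \<bullet> \<xi>)) * u \<xi>)"

text \<open>The corresponding operations on tempered distributions, by duality.\<close>

definition dist_fourier :: "'a::euclidean_space functional \<Rightarrow> 'a functional" where
  "dist_fourier T = (\<lambda>\<psi>. T (fourier \<psi>))"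

definition dist_inv_fourier :: "'a::euclidean_space functional \<Rightarrow> 'a functional" where
  "dist_inv_fourier T = (\<lambda>\<psi>. T (inv_fourier \<psi>))"

definition dist_mult :: "('a::euclidean_space \<Rightarrow> real) \<Rightarrow> 'a functional \<Rightarrow> 'a functional" where
  "dist_mult m T = (\<lambda>\<psi>. T (\<lambda>x. of_real (m x) * \<psi> x))"


section \<open>Lebesgue norms\<close>

definition enn_powr :: "ennreal \<Rightarrow> real \<Rightarrow> ennreal" where
  "enn_powr x a = (if x = \<infinity> then \<infinity> else ennreal (enn2real x powr a))"

text \<open>\<open>p\<close> ranges over \<open>[1, \<infinity>]\<close>. With a counting measure this is the \<open>\<ell>\<^sup>p\<close> norm.\<close>

definition eLp_norm :: "'a measure \<Rightarrow> ennreal \<Rightarrow> ('a \<Rightarrow> ennreal) \<Rightarrow> ennreal" where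
  "eLp_norm M p f =
     (if p = \<infinity> then esssup M f
      else enn_powr (\<integral>\<^sup>+x. enn_powr (f x) (enn2real p) \<partial>M) (1 / enn2real p))"

definition Lp_norm :: "ennreal \<Rightarrow> ('a::euclidean_space \<Rightarrow> complex) \<Rightarrow> ennreal" where
  "Lp_norm p g = eLp_norm lborel p (\<lambda>x. ennreal (norm (g x)))"

text \<open>The representing function is unique almost everywhere, so the infimum is its norm if it
  exists; otherwise the infimum is taken over the empty set and equals \<open>\<infinity>\<close>.\<close>

definition dist_Lp_norm :: "ennreal \<Rightarrow> 'a::euclidean_space functional \<Rightarrow> ennreal" where
  "dist_Lp_norm p T = (INF g\<in>{g. represents g T}. Lp_norm p g)"


section \<open>Nonhomogeneous Besov spaces\<close>

definition lp_cutoff :: "('a::euclidean_space \<Rightarrow> real) \<Rightarrow> bool" where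
  "lp_cutoff \<theta> \<longleftrightarrow> smooth \<theta> \<and> (\<forall>\<xi> \<eta>. norm \<xi> = norm \<eta> \<longrightarrow> \<theta> \<xi> = \<theta> \<eta>) \<and>
     (\<forall>\<xi>. 0 \<le> \<theta> \<xi> \<and> \<theta> \<xi> \<le> 1) \<and>
     (\<forall>\<xi>. norm \<xi> \<le> 3/4 \<longrightarrow> \<theta> \<xi> = 1) \<and> (\<forall>\<xi>. norm \<xi> \<ge> 4/3 \<longrightarrow> \<theta> \<xi> = 0)"

definition lp_phi :: "('a::euclidean_space \<Rightarrow> real) \<Rightarrow> 'a \<Rightarrow> real" where
  "lp_phi \<theta> \<xi> = \<theta> (\<xi> /\<^sub>R 2) - \<theta> \<xi>"

text \<open>Only the indices \<open>j \<ge> -1\<close> are used.\<close>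

definition lp_block :: "('a::euclidean_space \<Rightarrow> real) \<Rightarrow> int \<Rightarrow> 'a functional \<Rightarrow> 'a functional" where
  "lp_block \<theta> j T = dist_inv_fourier
     (dist_mult (if j = -1 then \<theta> else (\<lambda>\<xi>. lp_phi \<theta> (2 powi (- j) *\<^sub>R \<xi>))) (dist_fourier T))"

definition besov_norm ::
  "('a::euclidean_space \<Rightarrow> real) \<Rightarrow> real \<Rightarrow> ennreal \<Rightarrow> ennreal \<Rightarrow> 'a functional \<Rightarrow> ennreal" where
  "besov_norm \<theta> s p r T = eLp_norm (count_space {-1..}) r
     (\<lambda>j. ennreal (2 powr (real_of_int j * s)) * dist_Lp_norm p (lp_block \<theta> j T))"

definition besov_space ::
  "('a::euclidean_space \<Rightarrow> real) \<Rightarrow> real \<Rightarrow> ennreal \<Rightarrow> ennreal \<Rightarrow> 'a functional set" where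
  "besov_space \<theta> s p r = {T. tempered_distribution T \<and> besov_norm \<theta> s p r T < \<infinity>}"

definition critical_exponent :: "nat \<Rightarrow> ennreal \<Rightarrow> real" where
  "critical_exponent d p = (if p = \<infinity> then 0 else real d / enn2real p)"


section \<open>The sequence\<close>

definition Gamma_seq :: "nat \<Rightarrow> real" where
  "Gamma_seq n = 1 / ln (ln (real n))"

definition f_seq :: "('a::euclidean_space \<Rightarrow> complex) \<Rightarrow> nat \<Rightarrow> 'a \<Rightarrow> complex" where
  "f_seq u n x = of_real (Gamma_seq n) * (\<Sum>k=1..n. 1 / of_nat k * u (2 ^ k *\<^sub>R x))"


section \<open>Integrable functions are tempered distributions\<close>

lemma schwartz_continuous: "schwartz f \<Longrightarrow> continuous_on UNIV f"
  unfolding schwartz_def smooth_def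
  by (metis differentiable_imp_continuous_within continuous_on_eq_continuous_within
      iter_partial.simps(1) lists.Nil)

lemma schwartz_bounded: "schwartz f \<Longrightarrow> bounded (range f)"
  unfolding schwartz_def
  by (metis (no_types, lifting) ext iter_partial.simps(1) lists.Nil power_0 scaleR_one)

lemma schwartz_le_seminorm:
  assumes "schwartz f" shows "norm (f x) \<le> schwartz_seminorm 0 f"
proof -
  have "{bs \<in> lists Basis. length bs \<le> 0} = {[] :: 'a list}" by auto
  then have "schwartz_seminorm 0 f = (SUP x. norm (f x))"
    by (simp add: schwartz_seminorm_def)
  moreover have "bdd_above (range (\<lambda>x. norm (f x)))"
    using schwartz_bounded[OF assms] by (auto simp: bounded_iff bdd_above_def)
  ultimately show ?thesis using cSUP_upper[of x UNIV "\<lambda>x. norm (f x)"] by simp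
qed

lemma integrable_mult_schwartz:
  fixes f :: "'a::euclidean_space \<Rightarrow> complex"
  assumes f: "integrable lborel f" and \<psi>: "schwartz \<psi>"
  shows "integrable lborel (\<lambda>x. f x * \<psi> x)"
proof (rule Bochner_Integration.integrable_bound)
  show "integrable lborel (\<lambda>x. schwartz_seminorm 0 \<psi> * norm (f x))"
    using f by simp
  have "\<psi> \<in> borel_measurable lborel"
    using schwartz_continuous[OF \<psi>] by (simp add: borel_measurable_continuous_onI)
  then show "(\<lambda>x. f x * \<psi> x) \<in> borel_measurable lborel"
    using f by measurable
  have "norm (f x * \<psi> x) \<le> norm (schwartz_seminorm 0 \<psi> * norm (f x))" for x
  proof -
    have "norm (f x) * norm (\<psi> x) \<le> norm (f x) * \<bar>schwartz_seminorm 0 \<psi>\<bar>"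
      by (intro mult_left_mono order_trans[OF schwartz_le_seminorm[OF \<psi>]]) auto
    then show ?thesis by (simp add: norm_mult abs_mult mult.commute)
  qed
  then show "AE x in lborel. norm (f x * \<psi> x) \<le> norm (schwartz_seminorm 0 \<psi> * norm (f x))"
    by simp
qed

lemma tempered_distribution_dist_of:
  assumes f: "integrable lborel f" shows "tempered_distribution (dist_of f)"
  unfolding tempered_distribution_def
proof (intro conjI allI impI)
  fix g h :: "'a \<Rightarrow> complex" assume "schwartz g" "schwartz h"
  then show "dist_of f (\<lambda>x. g x + h x) = dist_of f g + dist_of f h"
    by (simp add: dist_of_def distrib_left integrable_mult_schwartz[OF f])
next
  fix c and g :: "'a \<Rightarrow> complex"
  show "dist_of f (\<lambda>x. c * g x) = c * dist_of f g"
    by (simp add: dist_of_def mult.left_commute)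
next
  have "norm (dist_of f g) \<le> (LINT x|lborel. norm (f x)) * schwartz_seminorm 0 g"
    if g: "schwartz g" for g
  proof -
    have "norm (dist_of f g) \<le> (LINT x|lborel. norm (f x * g x))"
      unfolding dist_of_def by (rule integral_norm_bound)
    also have "\<dots> \<le> (LINT x|lborel. norm (f x) * schwartz_seminorm 0 g)"
      using f integrable_norm[OF integrable_mult_schwartz[OF f g]]
      by (intro integral_mono) (auto simp: norm_mult intro!: mult_left_mono schwartz_le_seminorm[OF g])
    finally show ?thesis by simp
  qed
  then show "\<exists>C N. \<forall>g. schwartz g \<longrightarrow> norm (dist_of f g) \<le> C * schwartz_seminorm N g"
    by blast
qed

end

theory Submission
  imports Defs "HOL-Probability.Characteristic_Functions" "HOL-Probability.Sinc_Integral"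
begin

text \<open>The point is that the Littlewood-Paley decomposition of \<open>f\<^sub>n\<close> is the sum that defines it. The spectrum of
  \<open>\<chi>(2\<^sup>k\<cdot>)\<close> lies in the annulus \<open>2\<^sup>k [4/3, 3/2]\<close>. On this annulus the symbol of the block \<open>\<Delta>\<^sub>j\<close> is
  \<open>1\<close> for \<open>j = k\<close> and \<open>0\<close> for every other \<open>j\<close> (\<open>lp_symbol_annulus\<close>). Hence \<open>\<Delta>\<^sub>j f\<^sub>n = \<Gamma>\<^sub>n / j \<chi>(2\<^sup>j\<cdot>)\<close>
  for \<open>1 \<le> j \<le> n\<close>, and all the other blocks vanish (\<open>lp_block_f_seq\<close>). Since
  \<open>2\<^bsup>jd/p\<^esup>\<close> is exactly the factor that a dilation by \<open>2\<^sup>j\<close> takes from an \<open>L\<^sup>p\<close> norm, each block contributes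
  a constant times \<open>\<Gamma>\<^sub>n / j\<close> to the Besov norm, and the harmonic sum gives \<open>\<Gamma>\<^sub>n ln n\<close>.

  The block of a distribution is defined by duality, so identifying it with a function takes the
  multiplication formula \<open>\<integral> f \<F>h = \<integral> \<F>f h\<close> and Fourier inversion (\<open>fourier_inversion\<close>); the compact spectrum of
  \<open>\<chi>\<close> makes the transforms integrable. The norm of a block is an infimum over all functions that
  represent it. For the upper bound it is enough to insert the explicit one (\<open>Lp_norm_dilation_le\<close>). For the
  lower bound, an arbitrary representing function is tested against the Schwartz function
  \<open>cnj (\<chi>(2\<^sup>j\<cdot>))\<close> (\<open>Lp_norm_ge_of_pairing\<close>).

  The supremum of \<open>f\<^sub>n\<close> stays of size \<open>\<Gamma>\<^sub>n\<close> because \<open>\<chi>(0) = 0\<close> and the decay of \<open>\<chi>\<close> give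
  \<open>\<bar>\<chi>(y)\<bar> \<lesssim> min \<bar>y\<bar> (1 / \<bar>y\<bar>)\<close>, so that at each point the dyadic sum \<open>\<Sum>\<^sub>k \<bar>\<chi>(2\<^sup>k x)\<bar>\<close> is dominated by two
  geometric series (\<open>f_seq_bound\<close>).\<close>

section \<open>Lebesgue integrals on Euclidean spaces\<close>

lemma nn_integral_lborel_affine:
  fixes f :: "'a::euclidean_space \<Rightarrow> ennreal" and c :: real
  assumes [measurable]: "f \<in> borel_measurable borel" and c: "c \<noteq> 0"
  shows "(\<integral>\<^sup>+x. f x \<partial>lborel) = ennreal (\<bar>c\<bar> ^ DIM('a)) * (\<integral>\<^sup>+x. f (t + c *\<^sub>R x) \<partial>lborel)"
  by (subst lborel_affine[OF c, of t]) (simp add: nn_integral_density nn_integral_distr nn_integral_cmult)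

lemma lborel_integral_affine:
  fixes f :: "'a::euclidean_space \<Rightarrow> 'b::{banach, second_countable_topology}" and c :: real
  assumes [measurable]: "f \<in> borel_measurable borel" and c: "c \<noteq> 0"
  shows "(LINT x|lborel. f x) = \<bar>c\<bar> ^ DIM('a) *\<^sub>R (LINT x|lborel. f (t + c *\<^sub>R x))"
  by (subst lborel_affine[OF c, of t]) (simp add: integral_density integral_distr)

lemma lborel_integrable_affine:
  fixes f :: "'a::euclidean_space \<Rightarrow> 'b::{banach, second_countable_topology}" and c :: real
  assumes f: "integrable lborel f" and c: "c \<noteq> 0"
  shows "integrable lborel (\<lambda>x. f (t + c *\<^sub>R x))"
proof -
  have [measurable]: "f \<in> borel_measurable borel" using f by auto
  have "ennreal (\<bar>c\<bar> ^ DIM('a)) * (\<integral>\<^sup>+x. norm (f (t + c *\<^sub>R x)) \<partial>lborel) < \<infinity>"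
    using f nn_integral_lborel_affine[of "\<lambda>x. ennreal (norm (f x))" c t] c
    by (simp add: integrable_iff_bounded)
  then have "(\<integral>\<^sup>+x. norm (f (t + c *\<^sub>R x)) \<partial>lborel) < \<infinity>"
    using c by (auto simp: ennreal_mult_less_top)
  then show ?thesis by (simp add: integrable_iff_bounded)
qed

lemma
  fixes f :: "'a::euclidean_space \<Rightarrow> real \<Rightarrow> 'b::{real_normed_field, banach, second_countable_topology}"
  assumes f: "\<And>b. b \<in> Basis \<Longrightarrow> integrable lborel (f b)"
  shows lborel_integrable_prod: "integrable lborel (\<lambda>x::'a. \<Prod>b\<in>Basis. f b (x \<bullet> b))"
    and lborel_integral_prod:
      "(\<integral>x. (\<Prod>b\<in>Basis. f b (x \<bullet> b)) \<partial>lborel) = (\<Prod>b\<in>Basis. LINT t|lborel. f b t)"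
proof -
  interpret product_sigma_finite "\<lambda>_::'a. lborel :: real measure" ..
  have [measurable]: "f b \<in> borel_measurable borel" if "b \<in> Basis" for b
    using f[OF that] by auto
  have [measurable]: "(\<lambda>f. \<Sum>b\<in>Basis. f b *\<^sub>R b) \<in> (\<Pi>\<^sub>M b\<in>(Basis::'a set). (lborel::real measure)) \<rightarrow>\<^sub>M borel"
    by measurable
  have [measurable]: "(\<lambda>x::'a. \<Prod>b\<in>Basis. f b (x \<bullet> b)) \<in> borel_measurable borel"
    by measurable
  show "integrable lborel (\<lambda>x::'a. \<Prod>b\<in>Basis. f b (x \<bullet> b))"
    by (subst lborel_eq, subst integrable_distr_eq) (auto intro!: product_integrable_prod f)
  show "(\<integral>x. (\<Prod>b\<in>Basis. f b (x \<bullet> b)) \<partial>lborel) = (\<Prod>b\<in>Basis. LINT t|lborel. f b t)"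
    by (subst lborel_eq, subst integral_distr) (auto intro!: product_integral_prod f)
qed

lemma integrable_inverse_1_plus_square_lborel:
  "integrable lborel (\<lambda>t::real. 1 / (1 + t\<^sup>2))"
  using integrable_inverse_1_plus_square
  by (simp add: set_integrable_def inverse_eq_divide)

text \<open>The weight \<open>\<Prod>\<^sub>b 1 / (1 + x\<^sub>b\<^sup>2)\<close> is integrable, being a product of functions of one coordinate each,
  and its inverse grows at most like \<open>\<bar>x\<bar>\<^bsup>2d\<^esup>\<close>, which the decay of a Schwartz function absorbs.\<close>

lemma schwartz_integrable:
  fixes f :: "'a::euclidean_space \<Rightarrow> complex"
  assumes f: "schwartz f" shows "integrable lborel f"
proof -
  let ?d = "DIM('a)"
  have "bounded (range (\<lambda>x. norm x ^ k *\<^sub>R f x))" for k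
    using f unfolding schwartz_def by (metis iter_partial.simps(1) lists.Nil)
  then have bd: "\<exists>C. \<forall>x. norm (norm x ^ k *\<^sub>R f x) \<le> C" for k
    unfolding bounded_iff by auto
  obtain C where C: "\<And>x. norm (norm x ^ 0 *\<^sub>R f x) \<le> C"
    using bd by blast
  obtain D where D: "\<And>x. norm (norm x ^ (2 * ?d) *\<^sub>R f x) \<le> D"
    using bd by blast
  have *: "(1 + r\<^sup>2) ^ n \<le> 2 ^ n * (1 + r ^ (2 * n))" for r :: real and n :: nat
  proof (cases "r\<^sup>2 \<le> 1")
    case True
    then have "(1 + r\<^sup>2) ^ n \<le> 2 ^ n" by (intro power_mono) auto
    then show ?thesis by (simp add: power_mult distrib_left add_increasing2)
  next
    case False
    then have "(1 + r\<^sup>2) ^ n \<le> (2 * r\<^sup>2) ^ n" by (intro power_mono) auto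
    then show ?thesis by (simp add: power_mult power_mult_distrib distrib_left add_increasing)
  qed
  let ?w = "\<lambda>x::'a. \<Prod>b\<in>Basis. 1 / (1 + (x \<bullet> b)\<^sup>2)"
  have w: "integrable lborel ?w"
    by (rule lborel_integrable_prod) (rule integrable_inverse_1_plus_square_lborel)
  show ?thesis
  proof (rule Bochner_Integration.integrable_bound[OF integrable_mult_right[OF w, of "2 ^ ?d * (C + D)"]])
    show "f \<in> borel_measurable lborel"
      using schwartz_continuous[OF f] by (simp add: borel_measurable_continuous_onI)
    have "norm (f x) \<le> 2 ^ ?d * (C + D) * ?w x" for x
    proof -
      have "(\<Prod>b\<in>(Basis::'a set). 1 + (x \<bullet> b)\<^sup>2) \<le> (\<Prod>b\<in>(Basis::'a set). 1 + (norm x)\<^sup>2)"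
        by (intro prod_mono) (auto simp: power2_le_iff_abs_le abs_le_square_iff[symmetric] Basis_le_norm)
      also have "\<dots> = (1 + (norm x)\<^sup>2) ^ ?d" by simp
      also have "\<dots> \<le> 2 ^ ?d * (1 + norm x ^ (2 * ?d))" by (rule *)
      finally have "(\<Prod>b\<in>(Basis::'a set). 1 + (x \<bullet> b)\<^sup>2) * norm (f x) \<le> 2 ^ ?d * (1 + norm x ^ (2 * ?d)) * norm (f x)"
        by (rule mult_right_mono) simp
      also have "\<dots> \<le> 2 ^ ?d * (C + D)"
        using C[of x] D[of x] by (simp add: distrib_right mult.assoc)
      finally have "(\<Prod>b\<in>(Basis::'a set). 1 + (x \<bullet> b)\<^sup>2) * norm (f x) \<le> 2 ^ ?d * (C + D)" .
      moreover have "(\<Prod>b\<in>(Basis::'a set). 1 + (x \<bullet> b)\<^sup>2) > 0"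
        by (intro prod_pos) (auto simp: add_pos_nonneg)
      ultimately show ?thesis by (simp add: prod_dividef field_simps)
    qed
    then show "AE x in lborel. norm (f x) \<le> norm (2 ^ ?d * (C + D) * ?w x)"
      by (intro AE_I2) (metis abs_ge_self order_trans real_norm_def)
  qed
qed

section \<open>The Fourier transform of a Gaussian\<close>

text \<open>Up to normalisation, this is the characteristic function of the standard normal distribution.\<close>

lemma gaussian_fourier_real:
  "integrable lborel (\<lambda>t::real. exp (\<i> * of_real (t * a)) * of_real (exp (- (t\<^sup>2) / 2)))"
  "(LINT t|lborel. exp (\<i> * of_real (t * a)) * of_real (exp (- (t\<^sup>2) / 2))) =
     complex_of_real (sqrt (2 * pi) * exp (- (a\<^sup>2) / 2))"
proof -
  let ?k = "\<lambda>t::real. exp (\<i> * of_real (t * a))"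
  have [measurable]: "?k \<in> borel_measurable borel"
    by (intro borel_measurable_continuous_onI continuous_intros)
  have eq: "?k t * of_real (exp (- (t\<^sup>2) / 2)) = complex_of_real (sqrt (2 * pi)) * (std_normal_density t *\<^sub>R ?k t)" for t
    by (simp add: normal_density_def scaleR_conv_of_real)
  have "integrable lborel (\<lambda>t. std_normal_density t *\<^sub>R ?k t)"
    by (rule Bochner_Integration.integrable_bound[OF integrable_normal_density[of 1 0]]) auto
  then show "integrable lborel (\<lambda>t. ?k t * of_real (exp (- (t\<^sup>2) / 2)))"
    unfolding eq by (rule integrable_mult_right)
  have "char std_normal_distribution a = (LINT t|lborel. std_normal_density t *\<^sub>R iexp (a * t))"
    unfolding char_def by (subst integral_density) (auto simp: normal_density_nonneg)
  then have "(LINT t|lborel. std_normal_density t *\<^sub>R ?k t) = of_real (exp (- (a\<^sup>2) / 2))"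
    by (simp add: char_std_normal_distribution mult.commute)
  then show "(LINT t|lborel. ?k t * of_real (exp (- (t\<^sup>2) / 2))) =
     complex_of_real (sqrt (2 * pi) * exp (- (a\<^sup>2) / 2))"
    unfolding eq integral_mult_right_zero by simp
qed

lemma sum_inner_Basis_sq: "(\<Sum>b\<in>Basis. (x \<bullet> b)\<^sup>2) = (norm (x::'a::euclidean_space))\<^sup>2"
  unfolding power2_norm_eq_inner euclidean_inner[of x x] by (simp add: power2_eq_square)

lemma
  fixes a :: "'a::euclidean_space"
  shows gaussian_fourier_integrable: "integrable lborel (\<lambda>x::'a. exp (\<i> * of_real (x \<bullet> a)) * of_real (exp (- ((norm x)\<^sup>2) / 2)))"
  and gaussian_fourier_integral: "(LINT x|lborel. exp (\<i> * of_real (x \<bullet> a)) * of_real (exp (- ((norm x)\<^sup>2) / 2))) =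
     complex_of_real ((2 * pi) powr (real DIM('a) / 2) * exp (- ((norm a)\<^sup>2) / 2))"
proof -
  have eq: "exp (\<i> * of_real (x \<bullet> a)) * of_real (exp (- ((norm x)\<^sup>2) / 2)) =
      (\<Prod>b\<in>Basis. exp (\<i> * of_real ((x \<bullet> b) * (a \<bullet> b))) * complex_of_real (exp (- ((x \<bullet> b)\<^sup>2) / 2)))" for x
    unfolding sum_inner_Basis_sq[symmetric]
    by (simp add: prod.distrib exp_sum[symmetric] euclidean_inner[of x a] sum_distrib_left sum_negf sum_divide_distrib
        flip: exp_of_real)
  show "integrable lborel (\<lambda>x::'a. exp (\<i> * of_real (x \<bullet> a)) * of_real (exp (- ((norm x)\<^sup>2) / 2)))"
    unfolding eq by (rule lborel_integrable_prod) (rule gaussian_fourier_real)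
  have "(LINT x|lborel. exp (\<i> * of_real (x \<bullet> a)) * of_real (exp (- ((norm x)\<^sup>2) / 2))) =
    (\<Prod>b\<in>(Basis::'a set). complex_of_real (sqrt (2 * pi) * exp (- ((a \<bullet> b)\<^sup>2) / 2)))"
    unfolding eq by (subst lborel_integral_prod) (auto simp only: gaussian_fourier_real)
  also have "\<dots> = complex_of_real (sqrt (2 * pi) ^ DIM('a) * exp (- ((norm a)\<^sup>2) / 2))"
    by (simp add: prod.distrib exp_sum[symmetric] sum_inner_Basis_sq[symmetric] sum_negf sum_divide_distrib
        flip: exp_of_real)
  also have "sqrt (2 * pi) ^ DIM('a) = (2 * pi) powr (real DIM('a) / 2)"
    by (simp add: powr_half_sqrt[symmetric] powr_powr powr_realpow[symmetric])
  finally show "(LINT x|lborel. exp (\<i> * of_real (x \<bullet> a)) * of_real (exp (- ((norm x)\<^sup>2) / 2))) =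
     complex_of_real ((2 * pi) powr (real DIM('a) / 2) * exp (- ((norm a)\<^sup>2) / 2))" .
qed

section \<open>The multiplication formula and Fourier inversion\<close>

lemma integrable_exp_mult:
  fixes u :: "'a::euclidean_space \<Rightarrow> complex"
  assumes u: "integrable lborel u"
  shows "integrable lborel (\<lambda>x. exp (\<i> * of_real (x \<bullet> \<xi>)) * u x)"
proof (rule Bochner_Integration.integrable_bound[OF u])
  have [measurable]: "u \<in> borel_measurable borel" using u by auto
  show "(\<lambda>x. exp (\<i> * of_real (x \<bullet> \<xi>)) * u x) \<in> borel_measurable lborel"
    by measurable
qed (auto simp: norm_mult)

lemma inv_fourier_eq_fourier_uminus: "inv_fourier u x = fourier u (- x)"
  by (simp add: fourier_def inv_fourier_def inner_commute)

lemma fourier_uminus_eq_inv_fourier: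
  fixes u :: "'a::euclidean_space \<Rightarrow> complex"
  assumes [measurable]: "u \<in> borel_measurable borel"
  shows "fourier (\<lambda>x. u (- x)) \<xi> = inv_fourier u \<xi>"
proof -
  have "(LINT x|lborel. exp (\<i> * of_real (\<xi> \<bullet> x)) * u x) =
      (LINT x|lborel. exp (- \<i> * of_real (x \<bullet> \<xi>)) * u (- x))"
    using lborel_integral_affine[of "\<lambda>x. exp (\<i> * of_real (\<xi> \<bullet> x)) * u x" "-1" 0]
    by (simp add: inner_commute)
  then show ?thesis by (simp add: fourier_def inv_fourier_def)
qed

lemma fourier_measurable [measurable (raw)]:
  fixes u :: "'a::euclidean_space \<Rightarrow> complex"
  assumes [measurable]: "u \<in> borel_measurable borel"
  shows "fourier u \<in> borel_measurable borel"
  unfolding fourier_def by measurable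

lemma inv_fourier_measurable [measurable (raw)]:
  fixes u :: "'a::euclidean_space \<Rightarrow> complex"
  assumes [measurable]: "u \<in> borel_measurable borel"
  shows "inv_fourier u \<in> borel_measurable borel"
  unfolding inv_fourier_def by measurable

lemma fourier_bound:
  fixes u :: "'a::euclidean_space \<Rightarrow> complex"
  shows "norm (fourier u \<xi>) \<le> (2 * pi) powr (- real DIM('a) / 2) * (LINT x|lborel. norm (u x))"
proof -
  have "norm (LINT x|lborel. exp (- \<i> * of_real (x \<bullet> \<xi>)) * u x) \<le>
      (LINT x|lborel. norm (exp (- \<i> * of_real (x \<bullet> \<xi>)) * u x))"
    by (rule integral_norm_bound)
  also have "\<dots> = (LINT x|lborel. norm (u x))"
    by (simp add: norm_mult)
  finally show ?thesis
    by (simp add: fourier_def norm_mult mult_left_mono)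
qed

text \<open>Both sides are the double integral of \<open>exp (- \<i> x \<bullet> \<xi>) f(x) h(\<xi>)\<close>, in the two orders of integration.\<close>

lemma fourier_multiplication:
  fixes f h :: "'a::euclidean_space \<Rightarrow> complex"
  assumes f: "integrable lborel f" and h: "integrable lborel h"
  shows "(LINT x|lborel. f x * fourier h x) = (LINT \<xi>|lborel. fourier f \<xi> * h \<xi>)"
proof -
  have [measurable]: "f \<in> borel_measurable borel" "h \<in> borel_measurable borel"
    using f h by auto
  define K where "K = (\<lambda>(x::'a) (\<xi>::'a). exp (- \<i> * of_real (x \<bullet> \<xi>)) * (f x * h \<xi>))"
  have "integrable (lborel \<Otimes>\<^sub>M lborel) (case_prod K)"
  proof (rule lborel_pair.Fubini_integrable)
    show "case_prod K \<in> borel_measurable (lborel \<Otimes>\<^sub>M lborel)"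
      unfolding K_def by measurable
    have "(\<lambda>x. LINT \<xi>|lborel. norm (case_prod K (x, \<xi>))) = (\<lambda>x. norm (f x) * (LINT \<xi>|lborel. norm (h \<xi>)))"
      by (simp add: K_def norm_mult)
    then show "integrable lborel (\<lambda>x. LINT \<xi>|lborel. norm (case_prod K (x, \<xi>)))"
      using f by simp
    show "AE x in lborel. integrable lborel (\<lambda>\<xi>. case_prod K (x, \<xi>))"
    proof (rule AE_I2)
      fix x
      show "integrable lborel (\<lambda>\<xi>. case_prod K (x, \<xi>))"
        using integrable_mult_right[OF integrable_exp_mult[OF h, of "- x"], of "f x"]
        by (simp add: K_def inner_commute mult_ac)
    qed
  qed
  then have "(LINT \<xi>|lborel. LINT x|lborel. K x \<xi>) = (LINT x|lborel. LINT \<xi>|lborel. K x \<xi>)"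
    by (rule lborel_pair.Fubini_integral)
  moreover have "(LINT x|lborel. K x \<xi>) = (LINT x|lborel. exp (- \<i> * of_real (x \<bullet> \<xi>)) * f x) * h \<xi>" for \<xi>
    by (simp add: K_def mult.assoc[symmetric])
  moreover have "(LINT \<xi>|lborel. K x \<xi>) = f x * (LINT \<xi>|lborel. exp (- \<i> * of_real (\<xi> \<bullet> x)) * h \<xi>)" for x
  proof -
    have "(LINT \<xi>|lborel. K x \<xi>) = (LINT \<xi>|lborel. f x * (exp (- \<i> * of_real (\<xi> \<bullet> x)) * h \<xi>))"
      by (simp add: K_def inner_commute mult_ac)
    then show ?thesis by simp
  qed
  ultimately show ?thesis
    by (simp add: fourier_def mult.left_commute[of "f _"] mult.assoc)
qed

lemma inv_fourier_multiplication:
  fixes f h :: "'a::euclidean_space \<Rightarrow> complex"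
  assumes f: "integrable lborel f" and h: "integrable lborel h"
  shows "(LINT x|lborel. f x * inv_fourier h x) = (LINT \<xi>|lborel. inv_fourier f \<xi> * h \<xi>)"
proof -
  have [measurable]: "f \<in> borel_measurable borel" "h \<in> borel_measurable borel"
    using f h by auto
  have "integrable lborel (\<lambda>x. h (- x))"
    using lborel_integrable_affine[OF h, of "-1" 0] by simp
  from fourier_multiplication[OF f this]
  have "(LINT x|lborel. f x * inv_fourier h x) = (LINT \<xi>|lborel. fourier f \<xi> * h (- \<xi>))"
    by (simp add: fourier_uminus_eq_inv_fourier)
  also have "\<dots> = (LINT \<xi>|lborel. inv_fourier f \<xi> * h \<xi>)"
    using lborel_integral_affine[of "\<lambda>\<xi>. fourier f \<xi> * h (- \<xi>)" "-1" 0]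
    by (simp add: inv_fourier_eq_fourier_uminus)
  finally show ?thesis .
qed

lemma fourier_dilation:
  fixes u :: "'a::euclidean_space \<Rightarrow> complex"
  assumes [measurable]: "u \<in> borel_measurable borel" and c: "c > 0"
  shows "fourier (\<lambda>x. u (c *\<^sub>R x)) \<xi> = of_real ((1 / c) ^ DIM('a)) * fourier u (\<xi> /\<^sub>R c)"
proof -
  have "(LINT x|lborel. exp (- \<i> * of_real (x \<bullet> \<xi>)) * u (c *\<^sub>R x)) =
      \<bar>1 / c\<bar> ^ DIM('a) *\<^sub>R (LINT x|lborel. exp (- \<i> * of_real (x \<bullet> (\<xi> /\<^sub>R c))) * u x)"
    using c by (subst lborel_integral_affine[of _ "1 / c" 0]) (auto simp: divide_inverse)
  then show ?thesis using c by (simp add: fourier_def scaleR_conv_of_real)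
qed

lemma fourier_sum:
  fixes g :: "'i \<Rightarrow> 'a::euclidean_space \<Rightarrow> complex"
  assumes "\<And>k. k \<in> I \<Longrightarrow> integrable lborel (g k)"
  shows "fourier (\<lambda>x. \<Sum>k\<in>I. s k * g k x) \<xi> = (\<Sum>k\<in>I. s k * fourier (g k) \<xi>)"
proof -
  have "integrable lborel (\<lambda>x. exp (- \<i> * of_real (x \<bullet> \<xi>)) * g k x)" if "k \<in> I" for k
    using integrable_exp_mult[OF assms[OF that], of "- \<xi>"] by simp
  then show ?thesis
    by (simp add: fourier_def sum_distrib_left mult.left_commute[of _ "s _"])
qed

text \<open>Gaussian summability: the inversion integral with the extra factor \<open>G(e\<xi>)\<close> is, by the multiplication formula
  and the self-duality of the Gaussian, an average of \<open>u\<close> around \<open>x\<close> on the scale \<open>e\<close>. As \<open>e\<close> tends to \<open>0\<close>,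
  integrability of the transform gives the limit of the former, boundedness and continuity of \<open>u\<close> that of
  the latter.\<close>

theorem fourier_inversion:
  fixes u :: "'a::euclidean_space \<Rightarrow> complex"
  assumes u: "integrable lborel u" and cont: "continuous_on UNIV u" and bdd: "bounded (range u)"
    and Fu: "integrable lborel (fourier u)"
  shows "inv_fourier (fourier u) x = u x"
proof -
  let ?d = "DIM('a)"
  define G where "G = (\<lambda>y::'a. exp (- ((norm y)\<^sup>2) / 2))"
  have [measurable]: "u \<in> borel_measurable borel" using u by auto
  have [measurable]: "G \<in> borel_measurable borel" unfolding G_def by measurable
  have G: "(\<lambda>y. exp (\<i> * of_real (y \<bullet> a)) * of_real (G y)) = (\<lambda>y. exp (\<i> * of_real (y \<bullet> a)) * of_real (exp (- ((norm y)\<^sup>2) / 2)))" for a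
    by (simp add: G_def)
  have Gint: "integrable lborel (\<lambda>y. exp (\<i> * of_real (y \<bullet> a)) * of_real (G y))" for a
    unfolding G by (rule gaussian_fourier_integrable)
  have Gval: "(LINT y|lborel. exp (\<i> * of_real (y \<bullet> a)) * of_real (G y)) =
      complex_of_real ((2 * pi) powr (real ?d / 2) * G a)" for a
    unfolding G gaussian_fourier_integral by (simp add: G_def)
  have G0: "integrable lborel (\<lambda>y. complex_of_real (G y))"
      "(LINT y|lborel. complex_of_real (G y)) = of_real ((2 * pi) powr (real ?d / 2))"
    using Gint[of 0] Gval[of 0] by (simp_all add: G_def)
  have pi_cancel: "(2 * pi) powr (- real ?d / 2) * (2 * pi) powr (real ?d / 2) = 1"
    by (simp add: powr_add[symmetric])
  have reg: "(LINT \<xi>|lborel. fourier u \<xi> * (exp (\<i> * of_real (\<xi> \<bullet> x)) * of_real (G (e *\<^sub>R \<xi>)))) =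
      (LINT z|lborel. u (x + e *\<^sub>R z) * of_real (G z))" if e: "e > 0" for e
  proof -
    define h where "h = (\<lambda>\<xi>. exp (\<i> * of_real (\<xi> \<bullet> x)) * complex_of_real (G (e *\<^sub>R \<xi>)))"
    have "integrable lborel (\<lambda>\<xi>. complex_of_real (G (e *\<^sub>R \<xi>)))"
      using lborel_integrable_affine[OF G0(1), of e 0] e by simp
    then have h: "integrable lborel h"
      unfolding h_def by (rule integrable_exp_mult)
    have Fh: "fourier h y = of_real ((1 / e) ^ ?d * G ((x - y) /\<^sub>R e))" for y
    proof -
      have "exp (- \<i> * of_real (\<xi> \<bullet> y)) * h \<xi> =
          exp (\<i> * of_real (\<xi> \<bullet> (x - y))) * of_real (G (e *\<^sub>R \<xi>))" for \<xi>
        unfolding h_def mult.assoc[symmetric] exp_add[symmetric]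
        by (simp add: inner_diff_right algebra_simps)
      then have "(LINT \<xi>|lborel. exp (- \<i> * of_real (\<xi> \<bullet> y)) * h \<xi>) =
          (LINT \<xi>|lborel. exp (\<i> * of_real (\<xi> \<bullet> (x - y))) * of_real (G (e *\<^sub>R \<xi>)))"
        by simp
      also have "\<dots> = \<bar>1 / e\<bar> ^ ?d *\<^sub>R (LINT \<xi>|lborel. exp (\<i> * of_real (\<xi> \<bullet> ((x - y) /\<^sub>R e))) * of_real (G \<xi>))"
        using e by (subst lborel_integral_affine[of _ "1 / e" 0]) (auto simp: divide_inverse)
      also have "\<dots> = of_real ((1 / e) ^ ?d * ((2 * pi) powr (real ?d / 2) * G ((x - y) /\<^sub>R e)))"
        unfolding Gval using e by (simp add: scaleR_conv_of_real)
      finally have "fourier h y = of_real (((2 * pi) powr (- real ?d / 2) * (2 * pi) powr (real ?d / 2)) *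
          ((1 / e) ^ ?d * G ((x - y) /\<^sub>R e)))"
        unfolding fourier_def by (simp add: mult_ac)
      then show ?thesis unfolding pi_cancel by simp
    qed
    have "(LINT \<xi>|lborel. fourier u \<xi> * h \<xi>) = (LINT y|lborel. u y * fourier h y)"
      by (rule fourier_multiplication[OF u h, symmetric])
    also have "\<dots> = (LINT y|lborel. u y * of_real ((1 / e) ^ ?d * G ((x - y) /\<^sub>R e)))"
      unfolding Fh ..
    \<comment> \<open>the substitution \<open>y = x + e z\<close> cancels the factor \<open>(1 / e) ^ ?d\<close>\<close>
    also have "\<dots> = \<bar>e\<bar> ^ ?d *\<^sub>R (LINT z|lborel. u (x + e *\<^sub>R z) * of_real ((1 / e) ^ ?d * G ((x - (x + e *\<^sub>R z)) /\<^sub>R e)))"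
      using e by (subst lborel_integral_affine[of _ e x]) auto
    also have "\<dots> = (LINT z|lborel. \<bar>e\<bar> ^ ?d *\<^sub>R (u (x + e *\<^sub>R z) * of_real ((1 / e) ^ ?d * G ((x - (x + e *\<^sub>R z)) /\<^sub>R e))))"
      by simp
    also have "\<dots> = (LINT z|lborel. u (x + e *\<^sub>R z) * of_real (G z))"
      using e by (intro Bochner_Integration.integral_cong) (auto simp: G_def scaleR_conv_of_real power_divide field_simps)
    finally show ?thesis by (simp add: h_def)
  qed
  define e where "e = (\<lambda>n. 1 / real (Suc n))"
  have e: "e n > 0" for n by (simp add: e_def)
  have e0: "e \<longlonglongrightarrow> 0" unfolding e_def by (rule LIMSEQ_Suc[OF lim_1_over_n])
  have contG: "continuous_on UNIV G" unfolding G_def by (intro continuous_intros) auto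
  have lim1: "(\<lambda>n. LINT \<xi>|lborel. fourier u \<xi> * (exp (\<i> * of_real (\<xi> \<bullet> x)) * of_real (G (e n *\<^sub>R \<xi>))))
      \<longlonglongrightarrow> (LINT \<xi>|lborel. fourier u \<xi> * exp (\<i> * of_real (\<xi> \<bullet> x)))"
  proof (rule integral_dominated_convergence[where w = "\<lambda>\<xi>. norm (fourier u \<xi>)"])
    show "AE \<xi> in lborel. (\<lambda>n. fourier u \<xi> * (exp (\<i> * of_real (\<xi> \<bullet> x)) * of_real (G (e n *\<^sub>R \<xi>))))
        \<longlonglongrightarrow> fourier u \<xi> * exp (\<i> * of_real (\<xi> \<bullet> x))"
    proof (rule AE_I2)
      fix \<xi>
      have "(\<lambda>n. G (e n *\<^sub>R \<xi>)) \<longlonglongrightarrow> G (0 *\<^sub>R \<xi>)"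
        by (intro continuous_on_tendsto_compose[OF contG] tendsto_intros e0) auto
      then have "(\<lambda>n. complex_of_real (G (e n *\<^sub>R \<xi>))) \<longlonglongrightarrow> complex_of_real 1"
        by (intro tendsto_of_real) (simp add: G_def)
      then have "(\<lambda>n. fourier u \<xi> * (exp (\<i> * of_real (\<xi> \<bullet> x)) * of_real (G (e n *\<^sub>R \<xi>))))
        \<longlonglongrightarrow> fourier u \<xi> * (exp (\<i> * of_real (\<xi> \<bullet> x)) * complex_of_real 1)"
        by (intro tendsto_mult tendsto_const)
      then show "(\<lambda>n. fourier u \<xi> * (exp (\<i> * of_real (\<xi> \<bullet> x)) * of_real (G (e n *\<^sub>R \<xi>))))
        \<longlonglongrightarrow> fourier u \<xi> * exp (\<i> * of_real (\<xi> \<bullet> x))" by simp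
    qed
    show "AE \<xi> in lborel. norm (fourier u \<xi> * (exp (\<i> * of_real (\<xi> \<bullet> x)) * of_real (G (e n *\<^sub>R \<xi>)))) \<le> norm (fourier u \<xi>)" for n
      by (auto simp: norm_mult G_def intro!: mult_left_le)
  qed (use Fu in auto)
  obtain B where B: "\<And>y. norm (u y) \<le> B"
    using bdd by (auto simp: bounded_iff)
  have lim2: "(\<lambda>n. LINT z|lborel. u (x + e n *\<^sub>R z) * of_real (G z)) \<longlonglongrightarrow> (LINT z|lborel. u x * of_real (G z))"
  proof (rule integral_dominated_convergence[where w = "\<lambda>z. B * norm (complex_of_real (G z))"])
    show "AE z in lborel. (\<lambda>n. u (x + e n *\<^sub>R z) * of_real (G z)) \<longlonglongrightarrow> u x * of_real (G z)"
    proof (rule AE_I2)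
      fix z
      have "(\<lambda>n. u (x + e n *\<^sub>R z)) \<longlonglongrightarrow> u (x + 0 *\<^sub>R z)"
        by (intro continuous_on_tendsto_compose[OF cont] tendsto_intros e0) auto
      then show "(\<lambda>n. u (x + e n *\<^sub>R z) * of_real (G z)) \<longlonglongrightarrow> u x * of_real (G z)"
        by (intro tendsto_mult tendsto_const) simp
    qed
    show "integrable lborel (\<lambda>z. B * norm (complex_of_real (G z)))"
      by (intro integrable_mult_right integrable_norm G0)
    show "AE z in lborel. norm (u (x + e n *\<^sub>R z) * of_real (G z)) \<le> B * norm (complex_of_real (G z))" for n
      by (intro AE_I2) (simp only: norm_mult mult_right_mono B norm_ge_zero)
  qed auto
  have "(LINT \<xi>|lborel. fourier u \<xi> * exp (\<i> * of_real (\<xi> \<bullet> x))) = (LINT z|lborel. u x * of_real (G z))"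
    using lim1 lim2 unfolding reg[OF e] by (rule LIMSEQ_unique)
  then have "(LINT \<xi>|lborel. exp (\<i> * of_real (x \<bullet> \<xi>)) * fourier u \<xi>) = u x * of_real ((2 * pi) powr (real ?d / 2))"
    unfolding integral_mult_right_zero G0 by (simp add: mult.commute inner_commute)
  then have "inv_fourier (fourier u) x =
      of_real ((2 * pi) powr (- real ?d / 2) * (2 * pi) powr (real ?d / 2)) * u x"
    by (simp add: inv_fourier_def)
  then show ?thesis unfolding pi_cancel by simp
qed

lemma integrable_bounded_support:
  fixes v :: "'a::euclidean_space \<Rightarrow> 'b::{banach, second_countable_topology}"
  assumes [measurable]: "v \<in> borel_measurable borel"
    and M: "\<And>x. norm (v x) \<le> M" and R: "\<And>x. norm x > R \<Longrightarrow> v x = 0"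
  shows "integrable lborel v"
proof (rule Bochner_Integration.integrable_bound)
  show "integrable lborel (\<lambda>x. M * indicator (cball (0::'a) R) x)"
    by (intro integrable_mult_right integrable_real_indicator) (simp, rule emeasure_bounded_finite, simp)
  have "norm (v x) \<le> norm (M * indicator (cball (0::'a) R) x)" for x
    using M[of x] R[of x] by (auto simp: indicator_def)
  then show "AE x in lborel. norm (v x) \<le> norm (M * indicator (cball (0::'a) R) x)" by simp
qed auto

text \<open>The multiplication formula moves both transforms from the test function to \<open>f\<close>; there the symbol turns \<open>\<F>f\<close>
  into \<open>\<F>u\<close>, and Fourier inversion recovers \<open>u\<close>.\<close>

lemma dist_multiplier_eq:
  fixes f u \<psi> :: "'a::euclidean_space \<Rightarrow> complex"
  assumes f: "integrable lborel f" and m: "integrable lborel m"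
    and u: "integrable lborel u" and cont: "continuous_on UNIV u" and bdd: "bounded (range u)"
    and Fu: "integrable lborel (fourier u)" and \<psi>: "integrable lborel \<psi>"
    and eq: "\<And>\<xi>. fourier f \<xi> * of_real (m \<xi>) = fourier u \<xi>"
  shows "dist_inv_fourier (dist_mult m (dist_fourier (dist_of f))) \<psi> = dist_of u \<psi>"
proof -
  have [measurable]: "m \<in> borel_measurable borel" "\<psi> \<in> borel_measurable borel" using m \<psi> by auto
  let ?M = "(2 * pi) powr (- real DIM('a) / 2) * (LINT x|lborel. norm (\<psi> x))"
  have h: "integrable lborel (\<lambda>\<xi>. of_real (m \<xi>) * inv_fourier \<psi> \<xi>)"
  proof (rule Bochner_Integration.integrable_bound)
    show "integrable lborel (\<lambda>\<xi>. norm (m \<xi>) * ?M)"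
      using m by simp
    have "norm (of_real (m \<xi>) * inv_fourier \<psi> \<xi>) \<le> norm (m \<xi>) * ?M" for \<xi>
      using fourier_bound[of \<psi> "- \<xi>"]
      by (simp add: norm_mult inv_fourier_eq_fourier_uminus mult_left_mono)
    then show "AE \<xi> in lborel. norm (of_real (m \<xi>) * inv_fourier \<psi> \<xi>) \<le> norm (norm (m \<xi>) * ?M)"
      by (intro AE_I2) (metis abs_ge_self order_trans real_norm_def)
  qed measurable
  have "dist_inv_fourier (dist_mult m (dist_fourier (dist_of f))) \<psi> =
      (LINT x|lborel. f x * fourier (\<lambda>\<xi>. of_real (m \<xi>) * inv_fourier \<psi> \<xi>) x)"
    by (simp add: dist_inv_fourier_def dist_mult_def dist_fourier_def dist_of_def)
  also have "\<dots> = (LINT \<xi>|lborel. fourier f \<xi> * (of_real (m \<xi>) * inv_fourier \<psi> \<xi>))"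
    by (rule fourier_multiplication[OF f h])
  also have "\<dots> = (LINT \<xi>|lborel. fourier u \<xi> * inv_fourier \<psi> \<xi>)"
    by (simp add: eq mult.assoc[symmetric])
  also have "\<dots> = (LINT x|lborel. inv_fourier (fourier u) x * \<psi> x)"
    by (rule inv_fourier_multiplication[OF Fu \<psi>])
  also have "\<dots> = dist_of u \<psi>"
    by (simp add: dist_of_def fourier_inversion[OF u cont bdd Fu])
  finally show ?thesis .
qed

section \<open>Dilation and conjugation of Schwartz functions\<close>

lemma iter_partial_dilation:
  fixes f :: "'a::euclidean_space \<Rightarrow> 'b::real_normed_vector"
  assumes f: "smooth f" and "bs \<in> lists Basis"
  shows "iter_partial bs (\<lambda>x. f (c *\<^sub>R x)) = (\<lambda>x. c ^ length bs *\<^sub>R iter_partial bs f (c *\<^sub>R x))"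
  using assms(2)
proof (induction bs)
  case (Cons b bs)
  then have bs: "bs \<in> lists Basis" by simp
  let ?g = "iter_partial bs f"
  have "frechet_derivative (\<lambda>x. c ^ length bs *\<^sub>R ?g (c *\<^sub>R x)) (at x) b =
      c ^ length (b # bs) *\<^sub>R frechet_derivative ?g (at (c *\<^sub>R x)) b" for x
  proof -
    let ?D = "frechet_derivative ?g (at (c *\<^sub>R x))"
    have "?g differentiable (at (c *\<^sub>R x))"
      using f bs unfolding smooth_def by blast
    then have D: "(?g has_derivative ?D) (at (c *\<^sub>R x))"
      by (simp add: frechet_derivative_works)
    have "((\<lambda>x. c ^ length bs *\<^sub>R ?g (c *\<^sub>R x)) has_derivative (\<lambda>y. c ^ length bs *\<^sub>R ?D (c *\<^sub>R y))) (at x)"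
      by (rule has_derivative_scaleR_right,
          rule has_derivative_compose[where g = "?g" and g' = "?D" and f = "\<lambda>x. c *\<^sub>R x", OF _ D])
        (intro derivative_intros)
    then show ?thesis
      using has_derivative_linear[OF D]
      by (simp add: frechet_derivative_at[symmetric] linear_scale mult.commute)
  qed
  then show ?case using Cons.IH by simp
qed simp

lemma iter_partial_cnj:
  assumes f: "smooth f" and "bs \<in> lists Basis"
  shows "iter_partial bs (\<lambda>x. cnj (f x)) = (\<lambda>x. cnj (iter_partial bs f x))"
  using assms(2)
proof (induction bs)
  case (Cons b bs)
  then have bs: "bs \<in> lists Basis" by simp
  let ?g = "iter_partial bs f"
  have "frechet_derivative (\<lambda>x. cnj (?g x)) (at x) b = cnj (frechet_derivative ?g (at x) b)" for x
  proof -
    have "?g differentiable (at x)"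
      using f bs unfolding smooth_def by blast
    then have D: "(?g has_derivative frechet_derivative ?g (at x)) (at x)"
      by (simp add: frechet_derivative_works)
    show ?thesis
      using frechet_derivative_at[OF has_derivative_cnj[OF D]] by metis
  qed
  then show ?case using Cons.IH by simp
qed simp

lemma schwartz_dilation:
  fixes f :: "'a::euclidean_space \<Rightarrow> complex"
  assumes f: "schwartz f" and c: "c > 0"
  shows "schwartz (\<lambda>x. f (c *\<^sub>R x))"
  unfolding schwartz_def
proof (intro conjI allI ballI)
  have sm: "smooth f" using f by (simp add: schwartz_def)
  show "smooth (\<lambda>x. f (c *\<^sub>R x))"
    unfolding smooth_def
  proof (intro ballI allI)
    fix bs :: "'a list" and x assume bs: "bs \<in> lists Basis"
    have "iter_partial bs f differentiable (at (c *\<^sub>R x))"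
      using sm bs by (simp add: smooth_def)
    then have "(\<lambda>x. iter_partial bs f (c *\<^sub>R x)) differentiable (at x)"
      using differentiable_chain_at[of "\<lambda>x. c *\<^sub>R x" x "iter_partial bs f"]
        bounded_linear_imp_differentiable[OF bounded_linear_scaleR_right]
      by (simp add: o_def)
    then show "iter_partial bs (\<lambda>x. f (c *\<^sub>R x)) differentiable (at x)"
      by (simp add: iter_partial_dilation[OF sm bs])
  qed
  fix k and bs :: "'a list" assume bs: "bs \<in> lists Basis"
  then have "bounded (range (\<lambda>x. norm x ^ k *\<^sub>R iter_partial bs f x))"
    using f by (simp add: schwartz_def)
  then obtain B where B: "\<And>x. norm (norm x ^ k *\<^sub>R iter_partial bs f x) \<le> B"
    by (auto simp: bounded_iff)
  show "bounded (range (\<lambda>x. norm x ^ k *\<^sub>R iter_partial bs (\<lambda>x. f (c *\<^sub>R x)) x))"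
  proof (rule boundedI, clarify)
    fix x :: 'a
    have "norm (norm x ^ k *\<^sub>R iter_partial bs (\<lambda>x. f (c *\<^sub>R x)) x) =
        c ^ length bs / c ^ k * norm (norm (c *\<^sub>R x) ^ k *\<^sub>R iter_partial bs f (c *\<^sub>R x))"
      using c by (simp add: iter_partial_dilation[OF sm bs] power_mult_distrib)
    also have "\<dots> \<le> c ^ length bs / c ^ k * B"
      using c by (intro mult_left_mono B) auto
    finally show "norm (norm x ^ k *\<^sub>R iter_partial bs (\<lambda>x. f (c *\<^sub>R x)) x) \<le> c ^ length bs / c ^ k * B" .
  qed
qed

lemma schwartz_cnj:
  assumes f: "schwartz f" shows "schwartz (\<lambda>x. cnj (f x))"
  unfolding schwartz_def
proof (intro conjI allI ballI)
  have sm: "smooth f" using f by (simp add: schwartz_def)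
  show "smooth (\<lambda>x. cnj (f x))"
    unfolding smooth_def
  proof (intro ballI allI)
    fix bs :: "'a list" and x assume bs: "bs \<in> lists Basis"
    have "iter_partial bs f differentiable (at x)"
      using sm bs by (simp add: smooth_def)
    then show "iter_partial bs (\<lambda>x. cnj (f x)) differentiable (at x)"
      unfolding iter_partial_cnj[OF sm bs] differentiable_def using has_derivative_cnj by blast
  qed
  fix k and bs :: "'a list" assume bs: "bs \<in> lists Basis"
  then have "bounded (range (\<lambda>x. norm x ^ k *\<^sub>R iter_partial bs f x))"
    using f by (simp add: schwartz_def)
  then show "bounded (range (\<lambda>x. norm x ^ k *\<^sub>R iter_partial bs (\<lambda>x. cnj (f x)) x))"
    by (simp add: iter_partial_cnj[OF sm bs] bounded_iff)
qed

section \<open>The Littlewood-Paley blocks of the sequence\<close>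

definition lp_symbol :: "('a::euclidean_space \<Rightarrow> real) \<Rightarrow> int \<Rightarrow> 'a \<Rightarrow> real" where
  "lp_symbol \<theta> j = (if j = -1 then \<theta> else (\<lambda>\<xi>. lp_phi \<theta> (2 powi (- j) *\<^sub>R \<xi>)))"

lemma lp_cutoffD:
  assumes "lp_cutoff \<theta>"
  shows "0 \<le> \<theta> \<xi>" "\<theta> \<xi> \<le> 1" "norm \<xi> \<le> 3/4 \<Longrightarrow> \<theta> \<xi> = 1" "norm \<xi> \<ge> 4/3 \<Longrightarrow> \<theta> \<xi> = 0"
  using assms unfolding lp_cutoff_def by blast+

lemma lp_symbol_integrable:
  fixes \<theta> :: "'a::euclidean_space \<Rightarrow> real"
  assumes \<theta>: "lp_cutoff \<theta>"
  shows "integrable lborel (lp_symbol \<theta> j)"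
proof (rule integrable_bounded_support)
  have "\<theta> differentiable (at x)" for x
    using \<theta> unfolding lp_cutoff_def smooth_def by (metis iter_partial.simps(1) lists.Nil)
  then have "continuous_on UNIV \<theta>"
    by (meson continuous_at_imp_continuous_on differentiable_imp_continuous_within)
  then have [measurable]: "\<theta> \<in> borel_measurable borel"
    by (rule borel_measurable_continuous_onI)
  show "lp_symbol \<theta> j \<in> borel_measurable borel"
    by (cases "j = -1") (simp_all add: lp_symbol_def lp_phi_def)
  have 01: "0 \<le> \<theta> \<xi>" "\<theta> \<xi> \<le> 1" for \<xi>
    using lp_cutoffD[OF \<theta>] by auto
  show "norm (lp_symbol \<theta> j \<xi>) \<le> 1" for \<xi>
    using 01[of \<xi>] 01[of "2 powi (- j) *\<^sub>R \<xi>"] 01[of "(2 powi (- j) *\<^sub>R \<xi>) /\<^sub>R 2"]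
    by (auto simp: lp_symbol_def lp_phi_def)
  have 0: "\<theta> \<xi> = 0" if "norm \<xi> \<ge> 4/3" for \<xi>
    using lp_cutoffD[OF \<theta>] that by blast
  fix \<xi> :: 'a assume \<xi>: "norm \<xi> > max (4/3) (8/3 * 2 powi j)"
  have "norm (2 powi (- j) *\<^sub>R \<xi>) \<ge> 8/3"
    using \<xi> by (simp add: power_int_minus field_simps)
  then show "lp_symbol \<theta> j \<xi> = 0"
    using \<xi> 0[of \<xi>] 0[of "2 powi (- j) *\<^sub>R \<xi>"] 0[of "(2 powi (- j) *\<^sub>R \<xi>) /\<^sub>R 2"]
    by (auto simp: lp_symbol_def lp_phi_def)
qed

text \<open>After rescaling, \<open>\<phi>\<close> is evaluated at \<open>2\<^bsup>k-j\<^esup> \<eta>\<close>. For \<open>k = j\<close> this point lies in the annulus, where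
  \<open>\<theta>(\<eta>) = 0\<close> and \<open>\<theta>(\<eta>/2) = 1\<close>; for \<open>k > j\<close> its norm is at least \<open>8/3\<close> and both values of \<open>\<theta>\<close> are \<open>0\<close>; for
  \<open>k < j\<close> its norm is at most \<open>3/4\<close> and both values are \<open>1\<close>. The low-frequency symbol \<open>\<theta>\<close>, at \<open>j = - 1\<close>,
  vanishes because \<open>2\<^sup>k \<eta>\<close> has norm at least \<open>8/3\<close>.\<close>

lemma lp_symbol_annulus:
  fixes \<theta> :: "'a::euclidean_space \<Rightarrow> real"
  assumes \<theta>: "lp_cutoff \<theta>" and \<eta>: "4/3 \<le> norm \<eta>" "norm \<eta> \<le> 3/2" and k: "k \<ge> 1"
  shows "lp_symbol \<theta> j (2 ^ k *\<^sub>R \<eta>) = (if j = int k then 1 else 0)"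
proof -
  have th0: "\<theta> \<xi> = 0" if "norm \<xi> \<ge> 4/3" for \<xi>
    using lp_cutoffD[OF \<theta>] that by blast
  have th1: "\<theta> \<xi> = 1" if "norm \<xi> \<le> 3/4" for \<xi>
    using lp_cutoffD[OF \<theta>] that by blast
  show ?thesis
  proof (cases "j = -1")
    case True
    have "2 ^ k \<ge> (1::real)" by simp
    then have "1 * (4/3) \<le> 2 ^ k * norm \<eta>"
      using \<eta> by (intro mult_mono) auto
    then show ?thesis using True th0[of "2 ^ k *\<^sub>R \<eta>"] by (simp add: lp_symbol_def)
  next
    case False
    let ?a = "2 powi (int k - j) :: real"
    have eq: "2 powi (- j) *\<^sub>R 2 ^ k *\<^sub>R \<eta> = ?a *\<^sub>R \<eta>"
      by (simp add: power_int_diff power_int_minus field_simps)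
    consider "j = int k" | "int k - j \<ge> 1" | "int k - j \<le> -1" by linarith
    then have "lp_phi \<theta> (?a *\<^sub>R \<eta>) = (if j = int k then 1 else 0)"
    proof cases
      case 1
      then show ?thesis using th0[of \<eta>] assms th1[of "\<eta> /\<^sub>R 2"] by (simp add: lp_phi_def)
    next
      case 2
      then have "2 powi 1 \<le> ?a" by (intro power_int_increasing) auto
      then have "2 * (4/3) \<le> ?a * norm \<eta>"
        using \<eta> by (intro mult_mono) auto
      then show ?thesis using th0[of "?a *\<^sub>R \<eta>"] th0[of "(?a *\<^sub>R \<eta>) /\<^sub>R 2"] 2 by (simp add: lp_phi_def)
    next
      case 3
      then have "?a \<le> 2 powi (-1)" by (intro power_int_increasing) auto
      then have "?a * norm \<eta> \<le> (1/2) * (3/2)"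
        using \<eta> by (intro mult_mono) auto
      moreover have "0 \<le> ?a * norm \<eta>" by simp
      ultimately show ?thesis using th1[of "?a *\<^sub>R \<eta>"] th1[of "(?a *\<^sub>R \<eta>) /\<^sub>R 2"] 3 by (simp add: lp_phi_def mult.commute)
    qed
    then show ?thesis using False by (simp only: lp_symbol_def eq if_False)
  qed
qed

text \<open>The factor of \<open>\<chi>(2\<^sup>j\<cdot>)\<close> in the \<open>j\<close>-th block of \<open>f\<^sub>n\<close>. It is total in \<open>j\<close>, with value \<open>0\<close> where the block
  vanishes, so that all blocks are treated alike.\<close>

definition block_coeff :: "nat \<Rightarrow> int \<Rightarrow> real" where
  "block_coeff n j = (if 1 \<le> j \<and> j \<le> int n then Gamma_seq n / real_of_int j else 0)"

text \<open>The symbol of the block keeps the summand whose spectrum lies in its own annulus and kills the others.\<close>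

lemma lp_block_f_seq:
  fixes u :: "'a::euclidean_space \<Rightarrow> complex"
  assumes \<theta>: "lp_cutoff \<theta>"
    and u: "integrable lborel u" and cont: "continuous_on UNIV u" and bdd: "bounded (range u)"
    and supp: "\<And>\<eta>. fourier u \<eta> \<noteq> 0 \<Longrightarrow> 4/3 \<le> norm \<eta> \<and> norm \<eta> \<le> 3/2"
    and \<psi>: "integrable lborel \<psi>"
  shows "lp_block \<theta> j (dist_of (f_seq u n)) \<psi> =
    dist_of (\<lambda>x. of_real (block_coeff n j) * u (2 ^ nat j *\<^sub>R x)) \<psi>"
proof -
  have [measurable]: "u \<in> borel_measurable borel" using u by auto
  define g where "g = (\<lambda>k x. u (2 ^ k *\<^sub>R x))"
  have g: "integrable lborel (g k)" for k
    using lborel_integrable_affine[OF u, of "2 ^ k" 0] by (simp add: g_def)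
  have Fg: "fourier (g k) \<xi> = of_real ((1 / 2 ^ k) ^ DIM('a)) * fourier u (\<xi> /\<^sub>R 2 ^ k)" for k \<xi>
    unfolding g_def by (rule fourier_dilation) auto
  define s where "s = (\<lambda>k. complex_of_real (Gamma_seq n) / of_nat k)"
  have f: "f_seq u n = (\<lambda>x. \<Sum>k\<in>{1..n}. s k * g k x)"
    by (simp add: f_seq_def fun_eq_iff s_def g_def sum_distrib_left)
  have symb: "fourier (g k) \<xi> * of_real (lp_symbol \<theta> j \<xi>) = (if j = int k then fourier (g k) \<xi> else 0)"
    if "k \<ge> 1" for k \<xi>
  proof (cases "fourier u (\<xi> /\<^sub>R 2 ^ k) = 0")
    case False
    then have "lp_symbol \<theta> j (2 ^ k *\<^sub>R (\<xi> /\<^sub>R 2 ^ k)) = (if j = int k then 1 else 0)"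
      using supp[OF False] that by (intro lp_symbol_annulus[OF \<theta>]) blast+
    then show ?thesis by simp
  qed (simp add: Fg)
  let ?v = "\<lambda>x. complex_of_real (block_coeff n j) * g (nat j) x"
  have Fv: "fourier ?v \<xi> = of_real (block_coeff n j) * fourier (g (nat j)) \<xi>" for \<xi>
    using fourier_sum[of "{()}" "\<lambda>_. g (nat j)" "\<lambda>_. of_real (block_coeff n j)"] g by simp
  have "dist_inv_fourier (dist_mult (lp_symbol \<theta> j) (dist_fourier (dist_of (f_seq u n)))) \<psi> = dist_of ?v \<psi>"
  proof (rule dist_multiplier_eq[OF _ lp_symbol_integrable[OF \<theta>] _ _ _ _ \<psi>])
    show "integrable lborel (f_seq u n)" unfolding f using g by simp
    show "integrable lborel ?v" using g by simp
    show "continuous_on UNIV ?v"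
      unfolding g_def by (intro continuous_intros continuous_on_compose2[OF cont]) auto
    obtain B where "\<And>x. norm (u x) \<le> B" using bdd by (auto simp: bounded_iff)
    then show "bounded (range ?v)"
      by (intro boundedI[where B = "norm (complex_of_real (block_coeff n j)) * B"])
        (auto simp: g_def norm_mult intro!: mult_left_mono)
    show "integrable lborel (fourier ?v)"
    proof (rule integrable_bounded_support[OF _ fourier_bound])
      show "fourier ?v \<in> borel_measurable borel"
        unfolding g_def by measurable
      fix \<xi> :: 'a assume \<xi>: "2 ^ nat j * (3/2) < norm \<xi>"
      then have "\<not> norm (\<xi> /\<^sub>R 2 ^ nat j) \<le> 3/2" by (simp add: field_simps)
      then have "fourier u (\<xi> /\<^sub>R 2 ^ nat j) = 0" using supp by blast
      then show "fourier ?v \<xi> = 0" unfolding Fv Fg by simp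
    qed
    fix \<xi>
    have "fourier (f_seq u n) \<xi> * of_real (lp_symbol \<theta> j \<xi>) =
        (\<Sum>k\<in>{1..n}. s k * (fourier (g k) \<xi> * of_real (lp_symbol \<theta> j \<xi>)))"
      unfolding f by (subst fourier_sum[OF g]) (simp add: sum_distrib_right mult.assoc)
    also have "\<dots> = (\<Sum>k\<in>{1..n}. if k = nat j \<and> 1 \<le> j then s k * fourier (g k) \<xi> else 0)"
      by (intro sum.cong) (auto simp: symb)
    also have "\<dots> = fourier ?v \<xi>"
    proof (cases "1 \<le> j \<and> j \<le> int n")
      case True
      then have "nat j \<in> {1..n}" "of_nat (nat j) = (of_int j :: complex)" by auto
      then show ?thesis unfolding Fv using True by (simp add: block_coeff_def s_def)
    next
      case False
      then have "(\<Sum>k\<in>{1..n}. if k = nat j \<and> 1 \<le> j then s k * fourier (g k) \<xi> else 0) = 0"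
        by (intro sum.neutral) auto
      then show ?thesis unfolding Fv using False by (auto simp: block_coeff_def)
    qed
    finally show "fourier (f_seq u n) \<xi> * of_real (lp_symbol \<theta> j \<xi>) = fourier ?v \<xi>" .
  qed
  then show ?thesis by (simp add: lp_block_def lp_symbol_def g_def)
qed

section \<open>The size of a block from above and from below\<close>

lemma enn_powr_ennreal: "0 \<le> t \<Longrightarrow> enn_powr (ennreal t) a = ennreal (t powr a)"
  by (simp add: enn_powr_def)

lemma enn_powr_1: "enn_powr x 1 = x"
  by (cases x) (auto simp: enn_powr_def)

lemma ennreal_exponent_cases:
  assumes "1 \<le> (p::ennreal)"
  obtains "p = \<infinity>" | q where "p = ennreal q" "1 \<le> q"
  using assms by (cases p) auto

text \<open>For \<open>p = \<infinity>\<close> the constant is a bound \<open>B\<close> of \<open>u\<close>. For \<open>p = q < \<infinity>\<close> it is the \<open>L\<^sup>q\<close> norm of \<open>u\<close>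
  plus \<open>1\<close> to keep it positive, and this norm is finite because
  \<open>\<bar>u\<bar>\<^sup>q \<le> B\<^bsup>q-1\<^esup> \<bar>u\<bar>\<close>.\<close>

lemma Lp_norm_dilation_le:
  fixes u :: "'a::euclidean_space \<Rightarrow> complex"
  assumes u: "integrable lborel u" and bdd: "bounded (range u)" and p: "1 \<le> p"
  shows "\<exists>C>0. \<forall>s\<ge>0. \<forall>a>0. Lp_norm p (\<lambda>x. of_real s * u (a *\<^sub>R x)) \<le>
    ennreal (C * s * a powr (- critical_exponent DIM('a) p))"
proof -
  have [measurable]: "u \<in> borel_measurable borel" using u by auto
  obtain B where B0: "B > 0" and B: "\<And>x. norm (u x) \<le> B"
    using bdd by (auto simp: bounded_pos)
  show ?thesis
    using p
  proof (cases rule: ennreal_exponent_cases)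
    case 1
    have "Lp_norm p (\<lambda>x. of_real s * u (a *\<^sub>R x)) \<le> ennreal (B * s * a powr (- critical_exponent DIM('a) p))"
      if "s \<ge> 0" "a > 0" for s a
      unfolding Lp_norm_def eLp_norm_def using that 1 B
      by (auto simp: critical_exponent_def norm_mult mult.commute[of B] intro!: esssup_I AE_I2 ennreal_leI mult_left_mono)
    then show ?thesis using B0 by blast
  next
    case (2 q)
    let ?I = "LINT x|lborel. norm (u x) powr q"
    have le: "norm (u x) powr q \<le> B powr (q - 1) * norm (u x)" for x
    proof (cases "u x = 0")
      case False
      then have "norm (u x) powr q = norm (u x) powr (q - 1) * norm (u x)"
        by (simp add: powr_diff)
      also have "\<dots> \<le> B powr (q - 1) * norm (u x)"
        using B[of x] 2 by (intro mult_right_mono powr_mono2) auto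
      finally show ?thesis .
    qed simp
    have int: "integrable lborel (\<lambda>x. norm (u x) powr q)"
      by (rule Bochner_Integration.integrable_bound[of _ "\<lambda>x. B powr (q - 1) * norm (u x)"])
        (use u le in auto)
    have "Lp_norm p (\<lambda>x. of_real s * u (a *\<^sub>R x)) = ennreal ((?I powr (1 / q)) * s * a powr (- critical_exponent DIM('a) p))"
      if s: "s \<ge> 0" and a: "a > 0" for s a
    proof -
      have "(\<integral>\<^sup>+x. enn_powr (ennreal (norm (of_real s * u (a *\<^sub>R x)))) q \<partial>lborel) =
          (\<integral>\<^sup>+x. ennreal (s powr q * norm (u (a *\<^sub>R x)) powr q) \<partial>lborel)"
        using s by (simp add: enn_powr_ennreal norm_mult powr_mult)
      also have "\<dots> = ennreal (LINT x|lborel. s powr q * norm (u (a *\<^sub>R x)) powr q)"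
        using lborel_integrable_affine[OF int, of a 0] a by (intro nn_integral_eq_integral) auto
      also have "(LINT x|lborel. s powr q * norm (u (a *\<^sub>R x)) powr q) = s powr q * (a powr (- real DIM('a)) * ?I)"
        using lborel_integral_affine[of "\<lambda>x. norm (u x) powr q" a 0] a
        by (simp add: powr_minus powr_realpow)
      finally have "Lp_norm p (\<lambda>x. of_real s * u (a *\<^sub>R x)) =
          ennreal ((s powr q * (a powr (- real DIM('a)) * ?I)) powr (1 / q))"
        using 2 by (simp add: Lp_norm_def eLp_norm_def enn_powr_ennreal)
      also have "(s powr q * (a powr (- real DIM('a)) * ?I)) powr (1 / q) = ?I powr (1 / q) * s * a powr (- critical_exponent DIM('a) p)"
        using 2 s a by (simp add: powr_mult powr_powr critical_exponent_def mult_ac)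
      finally show ?thesis .
    qed
    moreover have "ennreal ((?I powr (1 / q)) * s * a powr (- critical_exponent DIM('a) p)) \<le>
       ennreal ((?I powr (1 / q) + 1) * s * a powr (- critical_exponent DIM('a) p))" if "s \<ge> 0" for s a
      using that by (intro ennreal_leI mult_right_mono) auto
    ultimately show ?thesis
      by (intro exI[of _ "?I powr (1 / q) + 1"]) (auto simp: add_nonneg_pos)
  qed
qed

text \<open>By continuity the set where \<open>u\<close> does not vanish is open, and a nonempty open set is not negligible.\<close>

lemma integral_norm_pos:
  fixes u :: "'a::euclidean_space \<Rightarrow> complex"
  assumes cont: "continuous_on UNIV u" and nz: "u \<noteq> (\<lambda>x. 0)" and r: "r > 0"
    and int: "integrable lborel (\<lambda>x. norm (u x) ^ r)"
  shows "(LINT x|lborel. norm (u x) ^ r) > 0"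
proof (rule ccontr)
  assume "\<not> ?thesis"
  moreover have "(LINT x|lborel. norm (u x) ^ r) \<ge> 0" by simp
  ultimately have "(LINT x|lborel. norm (u x) ^ r) = 0" by linarith
  then have "AE x in lborel. norm (u x) ^ r = 0"
    using int by (subst (asm) integral_nonneg_eq_0_iff_AE) auto
  then have "AE x in lborel. \<not> u x \<noteq> 0"
    using r by simp
  moreover have op: "open {x. u x \<noteq> 0}"
    using cont by (intro open_Collect_neq) auto
  ultimately have "{x. u x \<noteq> 0} \<in> null_sets lborel"
    by (subst (asm) AE_iff_null) (auto simp: pred_def intro!: borel_open)
  then have "negligible {x. u x \<noteq> 0}"
    by (simp add: negligible_iff_null_sets null_sets_completionI)
  then show False using op nz open_not_negligible by fastforce
qed

text \<open>This plays the part of Hoelder's inequality: integrated against a weight and with \<open>\<mu>\<close> chosen in proportion to the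
  pairing, it bounds the weighted integral of a function by the integral of its \<open>q\<close>-th power, up to a term that
  can be absorbed.\<close>

lemma le_add_powr:
  fixes t \<mu> q :: real
  assumes "t \<ge> 0" "\<mu> > 0" "q \<ge> 1"
  shows "t \<le> \<mu> + \<mu> powr (1 - q) * t powr q"
proof (cases "t \<le> \<mu>")
  case False
  then have "t = t powr (1 - q) * t powr q" using assms by (simp add: powr_add[symmetric])
  also have "\<dots> \<le> \<mu> powr (1 - q) * t powr q"
    using False assms by (intro mult_right_mono powr_mono2') auto
  finally show ?thesis using assms by simp
qed (simp add: add_increasing2)

text \<open>Pairing with \<open>cnj (u(a\<cdot>))\<close> gives \<open>s a\<^bsup>-d\<^esup> A\<close> with \<open>A = \<integral> \<bar>u\<bar>\<^sup>2 > 0\<close>, while a representing function with small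
  \<open>L\<^sup>p\<close> norm would make this pairing small. The dependence on \<open>a\<close> and \<open>s\<close> is tracked, so that one constant serves all
  dyadic scales.\<close>

lemma Lp_norm_ge_of_pairing:
  fixes u :: "'a::euclidean_space \<Rightarrow> complex"
  assumes u: "schwartz u" and nz: "u \<noteq> (\<lambda>x. 0)" and p: "1 \<le> p"
  shows "\<exists>c>0. \<forall>s\<ge>0. \<forall>a>0. \<forall>T g. represents g T \<longrightarrow>
    (\<forall>\<psi>. schwartz \<psi> \<longrightarrow> T \<psi> = dist_of (\<lambda>x. of_real s * u (a *\<^sub>R x)) \<psi>) \<longrightarrow>
    ennreal (c * s * a powr (- critical_exponent DIM('a) p)) \<le> Lp_norm p g"
proof -
  let ?d = "DIM('a)"
  have int: "integrable lborel u" by (rule schwartz_integrable[OF u])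
  then have [measurable]: "u \<in> borel_measurable borel" by auto
  have cont: "continuous_on UNIV u" by (rule schwartz_continuous[OF u])
  define L where "L = (LINT x|lborel. norm (u x))"
  define A where "A = (LINT x|lborel. (norm (u x))\<^sup>2)"
  have int2: "integrable lborel (\<lambda>x. (norm (u x))\<^sup>2)"
    using integrable_norm[OF integrable_mult_schwartz[OF int u]]
    by (simp add: norm_mult power2_eq_square)
  have L: "L > 0" using integral_norm_pos[OF cont nz, of 1] int by (simp add: L_def)
  have A: "A > 0" using integral_norm_pos[OF cont nz, of 2] int2 by (simp add: A_def)
  obtain B where B0: "B > 0" and B: "\<And>x. norm (u x) \<le> B"
    using schwartz_bounded[OF u] by (auto simp: bounded_pos)
  have nnL: "(\<integral>\<^sup>+x. ennreal (norm (u (a *\<^sub>R x))) \<partial>lborel) = ennreal (a powr (- real ?d) * L)" if a: "a > 0" for a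
  proof -
    have "(\<integral>\<^sup>+x. ennreal (norm (u (a *\<^sub>R x))) \<partial>lborel) = ennreal (LINT x|lborel. norm (u (a *\<^sub>R x)))"
      using lborel_integrable_affine[OF int, of a 0] a by (intro nn_integral_eq_integral) auto
    then show ?thesis
      using lborel_integral_affine[of "\<lambda>x. norm (u x)" a 0] a
      by (simp add: powr_minus powr_realpow L_def)
  qed
  have pairing: "ennreal (s * a powr (- real ?d) * A) \<le> (\<integral>\<^sup>+x. ennreal (norm (g x)) * ennreal (norm (u (a *\<^sub>R x))) \<partial>lborel)"
    if s: "s \<ge> 0" and a: "a > 0" and g: "represents g T"
      and T: "\<And>\<psi>. schwartz \<psi> \<Longrightarrow> T \<psi> = dist_of (\<lambda>x. of_real s * u (a *\<^sub>R x)) \<psi>" for s a T g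
  proof -
    let ?\<psi> = "\<lambda>x. cnj (u (a *\<^sub>R x))"
    have \<psi>: "schwartz ?\<psi>" by (intro schwartz_cnj schwartz_dilation u a)
    then have gi: "integrable lborel (\<lambda>x. g x * ?\<psi> x)" and "T ?\<psi> = dist_of g ?\<psi>"
      using g by (auto simp: represents_def)
    then have "dist_of g ?\<psi> = (LINT x|lborel. of_real s * u (a *\<^sub>R x) * ?\<psi> x)"
      using T[OF \<psi>] by (simp add: dist_of_def)
    also have "\<dots> = (LINT x|lborel. complex_of_real (s * (norm (u (a *\<^sub>R x)))\<^sup>2))"
      by (simp only: mult.assoc complex_norm_square[symmetric] of_real_mult)
    also have "\<dots> = of_real (LINT x|lborel. s * (norm (u (a *\<^sub>R x)))\<^sup>2)"
      by (rule integral_complex_of_real)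
    also have "(LINT x|lborel. s * (norm (u (a *\<^sub>R x)))\<^sup>2) = s * a powr (- real ?d) * A"
      using lborel_integral_affine[of "\<lambda>x. (norm (u x))\<^sup>2" a 0] a
      by (simp add: powr_minus powr_realpow A_def)
    finally have "ennreal (s * a powr (- real ?d) * A) = ennreal (norm (LINT x|lborel. g x * ?\<psi> x))"
      using s A by (simp add: dist_of_def norm_mult)
    also have "\<dots> \<le> (\<integral>\<^sup>+x. norm (g x * ?\<psi> x) \<partial>lborel)"
      by (rule integral_norm_bound_ennreal[OF gi])
    finally show ?thesis by (simp add: norm_mult ennreal_mult)
  qed
  show ?thesis
    using p
  proof (cases rule: ennreal_exponent_cases)
    case 1
    have "ennreal (A / L * s * a powr (- critical_exponent ?d p)) \<le> Lp_norm p g"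
      if s: "s \<ge> 0" and a: "a > 0" and g: "represents g T"
      and T: "\<And>\<psi>. schwartz \<psi> \<Longrightarrow> T \<psi> = dist_of (\<lambda>x. of_real s * u (a *\<^sub>R x)) \<psi>" for s a T g
    proof (cases "Lp_norm p g")
      case (real M)
      have AE: "AE x in lborel. ennreal (norm (g x)) \<le> ennreal M"
        using esssup_AE[of "\<lambda>x. ennreal (norm (g x))" lborel] real 1
        by (simp add: Lp_norm_def eLp_norm_def)
      have "ennreal (s * a powr (- real ?d) * A) \<le>
          (\<integral>\<^sup>+x. ennreal (norm (g x)) * ennreal (norm (u (a *\<^sub>R x))) \<partial>lborel)"
        by (rule pairing[OF s a g]) (rule T)
      also have "\<dots> \<le>
          (\<integral>\<^sup>+x. ennreal M * ennreal (norm (u (a *\<^sub>R x))) \<partial>lborel)"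
        using AE by (intro nn_integral_mono_AE) (auto elim!: eventually_mono intro: mult_right_mono)
      also have "\<dots> = ennreal (M * (a powr (- real ?d) * L))"
        using real a L by (simp add: nn_integral_cmult nnL ennreal_mult)
      finally have "s * a powr (- real ?d) * A \<le> M * (a powr (- real ?d) * L)"
        using real L by (subst (asm) ennreal_le_iff) auto
      then have "A / L * s \<le> M" using a L by (simp add: field_simps)
      then show ?thesis using real 1 a by (simp add: critical_exponent_def ennreal_leI)
    qed simp
    then show ?thesis using A L by (intro exI[of _ "A / L"]) auto
  next
    case (2 q)
    define K where "K = A / 2 * (A / (2 * L)) powr (q - 1) / B"
    have K: "K > 0" using A L B0 by (simp add: K_def)
    have "ennreal (K powr (1 / q) * s * a powr (- critical_exponent ?d p)) \<le> Lp_norm p g"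
      if s0: "s \<ge> 0" and a: "a > 0" and g: "represents g T"
      and T: "\<And>\<psi>. schwartz \<psi> \<Longrightarrow> T \<psi> = dist_of (\<lambda>x. of_real s * u (a *\<^sub>R x)) \<psi>" for s a T g
    proof -
      have [measurable]: "g \<in> borel_measurable borel" using g by (simp add: represents_def)
      define J where "J = (\<integral>\<^sup>+x. ennreal (norm (g x) powr q) \<partial>lborel)"
      have N: "Lp_norm p g = enn_powr J (1 / q)"
        using 2 by (simp add: Lp_norm_def eLp_norm_def enn_powr_ennreal J_def)
      show ?thesis
      proof (cases J)
        case (real j)
        show ?thesis
        proof (cases "s = 0")
          case False
          then have s: "s > 0" using s0 by simp
          \<comment> \<open>with this choice the first term of the splitting is half of the pairing\<close>
          define \<mu> where "\<mu> = s * (A / (2 * L))"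
          have \<mu>: "\<mu> > 0" using s A L by (simp add: \<mu>_def)
          have "ennreal (s * a powr (- real ?d) * A) \<le>
              (\<integral>\<^sup>+x. ennreal (norm (g x)) * ennreal (norm (u (a *\<^sub>R x))) \<partial>lborel)"
            by (rule pairing[OF s0 a g]) (rule T)
          also have "\<dots> \<le>
              (\<integral>\<^sup>+x. ennreal \<mu> * ennreal (norm (u (a *\<^sub>R x))) + ennreal (\<mu> powr (1 - q) * B) * ennreal (norm (g x) powr q) \<partial>lborel)"
          proof (rule nn_integral_mono)
            fix x
            have "norm (g x) * norm (u (a *\<^sub>R x)) \<le> (\<mu> + \<mu> powr (1 - q) * norm (g x) powr q) * norm (u (a *\<^sub>R x))"
              using le_add_powr[of "norm (g x)" \<mu> q] \<mu> 2 by (intro mult_right_mono) auto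
            also have "\<dots> \<le> \<mu> * norm (u (a *\<^sub>R x)) + \<mu> powr (1 - q) * norm (g x) powr q * B"
              unfolding distrib_right by (intro add_left_mono mult_left_mono B) auto
            finally show "ennreal (norm (g x)) * ennreal (norm (u (a *\<^sub>R x))) \<le>
                ennreal \<mu> * ennreal (norm (u (a *\<^sub>R x))) + ennreal (\<mu> powr (1 - q) * B) * ennreal (norm (g x) powr q)"
              using \<mu> B0 by (simp add: ennreal_mult[symmetric] ennreal_plus[symmetric] mult_ac del: ennreal_plus)
          qed
          also have "\<dots> = ennreal \<mu> * ennreal (a powr (- real ?d) * L) + ennreal (\<mu> powr (1 - q) * B) * J"
            using a by (simp add: nn_integral_add nn_integral_cmult nnL J_def)
          also have "\<dots> = ennreal (\<mu> * (a powr (- real ?d) * L) + \<mu> powr (1 - q) * B * j)"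
            using \<mu> B0 L real by (simp add: ennreal_mult[symmetric] ennreal_plus[symmetric] del: ennreal_plus)
          finally have "s * a powr (- real ?d) * A \<le> \<mu> * (a powr (- real ?d) * L) + \<mu> powr (1 - q) * B * j"
            using real L \<mu> B0 by (subst (asm) ennreal_le_iff) auto
          moreover have "\<mu> * (a powr (- real ?d) * L) = s * a powr (- real ?d) * A / 2"
            using L by (simp add: \<mu>_def)
          ultimately have "s * a powr (- real ?d) * (A / 2) \<le> \<mu> powr (1 - q) * B * j"
            by simp
          then have "\<mu> powr (q - 1) / B * (s * a powr (- real ?d) * (A / 2)) \<le> \<mu> powr (q - 1) / B * (\<mu> powr (1 - q) * B * j)"
            using B0 by (intro mult_left_mono) auto
          also have "\<dots> = (\<mu> powr (q - 1) * \<mu> powr (1 - q)) * j"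
            using B0 by simp
          also have "\<mu> powr (q - 1) * \<mu> powr (1 - q) = 1"
            using \<mu> by (simp add: powr_add[symmetric])
          also have "\<mu> powr (q - 1) / B * (s * a powr (- real ?d) * (A / 2)) = (s powr (q - 1) * s) * a powr (- real ?d) * K"
            using s A L by (simp add: \<mu>_def K_def powr_mult powr_divide mult_ac)
          also have "s powr (q - 1) * s = s powr q"
            using s by (simp add: powr_diff)
          finally have "(s powr q * a powr (- real ?d) * K) powr (1 / q) \<le> j powr (1 / q)"
            using 2 K by (intro powr_mono2) auto
          moreover have "(s powr q * a powr (- real ?d) * K) powr (1 / q) = K powr (1 / q) * s * a powr (- critical_exponent ?d p)"
            using 2 s a K by (simp add: powr_mult powr_powr critical_exponent_def mult_ac)
          ultimately show ?thesis
            using real N by (simp add: enn_powr_ennreal ennreal_leI)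
        qed simp
      qed (use N in \<open>simp add: enn_powr_def\<close>)
    qed
    then show ?thesis using K by (intro exI[of _ "K powr (1 / q)"]) auto
  qed
qed

section \<open>The uniform bound\<close>

text \<open>With \<open>h(r) = r / (1 + r)\<close>, the difference \<open>h(2r) - h(r)\<close> is comparable to \<open>min r (1/r)\<close>. Writing the
  bound on \<open>u\<close> in this form lets the sum over dyadic scales telescope.\<close>

lemma schwartz_dyadic_difference_bound:
  fixes u :: "'a::euclidean_space \<Rightarrow> complex"
  assumes u: "schwartz u" and u0: "u 0 = 0"
  shows "\<exists>C>0. \<forall>y. norm (u y) \<le> C * (2 * norm y / (1 + 2 * norm y) - norm y / (1 + norm y))"
proof -
  have diff: "u differentiable (at x)" for x
    using u unfolding schwartz_def smooth_def by (metis iter_partial.simps(1) lists.Nil)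
  have bd: "bounded (range (\<lambda>x. norm x ^ k *\<^sub>R iter_partial bs u x))" if "bs \<in> lists Basis" for k bs
    using u that by (simp add: schwartz_def)
  have "\<exists>B. \<forall>x. norm (frechet_derivative u (at x) b) \<le> B" if "b \<in> Basis" for b
    using bd[of "[b]" 0] that by (auto simp: bounded_iff)
  then obtain B where B: "\<And>b x. b \<in> Basis \<Longrightarrow> norm (frechet_derivative u (at x) b) \<le> B b"
    by metis
  \<comment> \<open>the mean value inequality, starting from the zero of \<open>u\<close> at the origin\<close>
  have lip: "norm (u y) \<le> (\<Sum>b\<in>Basis. B b) * norm y" for y
  proof -
    have "norm (u y - u 0) \<le> (\<Sum>b\<in>Basis. B b) * norm (y - 0)"
    proof (rule differentiable_bound[OF convex_UNIV])
      fix x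
      have D: "(u has_derivative frechet_derivative u (at x)) (at x)"
        using diff by (simp add: frechet_derivative_works)
      then show "(u has_derivative frechet_derivative u (at x)) (at x within UNIV)" by simp
      have "onorm (frechet_derivative u (at x)) \<le> (\<Sum>b\<in>Basis. norm (frechet_derivative u (at x) b))"
        by (rule onorm_componentwise[OF has_derivative_bounded_linear[OF D]])
      also have "\<dots> \<le> (\<Sum>b\<in>Basis. B b)"
        by (intro sum_mono B)
      finally show "onorm (frechet_derivative u (at x)) \<le> (\<Sum>b\<in>Basis. B b)" .
    qed auto
    then show ?thesis using u0 by simp
  qed
  obtain M where M: "\<And>y. norm y * norm (u y) \<le> M"
    using bd[of "[]" 1] by (auto simp: bounded_iff)
  define C where "C = max 1 (max (\<Sum>b\<in>Basis. B b) M)"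
  have C: "C \<ge> 1" "norm (u y) \<le> C * norm y" "norm y * norm (u y) \<le> C" for y
    using order_trans[OF lip[of y] mult_right_mono[of _ C]] M[of y] by (auto simp: C_def)
  have "norm (u y) \<le> 6 * C * (2 * norm y / (1 + 2 * norm y) - norm y / (1 + norm y))" for y
  proof -
    define r where "r = norm y"
    have r: "r \<ge> 0" by (simp add: r_def)
    have p: "(1 + 2 * r) * (1 + r) > 0" using r by simp
    have eq: "2 * r / (1 + 2 * r) - r / (1 + r) = r / ((1 + 2 * r) * (1 + r))"
      using r by (simp add: field_simps)
    have "norm (u y) * ((1 + 2 * r) * (1 + r)) \<le> 6 * C * r"
    proof (cases "r \<le> 1")
      case True
      then have "(1 + 2 * r) * (1 + r) \<le> 3 * 2" using r by (intro mult_mono) auto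
      then have "norm (u y) * ((1 + 2 * r) * (1 + r)) \<le> (C * r) * (3 * 2)"
        using C(2)[of y] p C(1) r by (intro mult_mono[of "norm (u y)"]) (simp_all add: r_def)
      then show ?thesis by simp
    next
      case False
      then have "(1 + 2 * r) * (1 + r) \<le> (3 * r) * (2 * r)" by (intro mult_mono) auto
      then have "norm (u y) * ((1 + 2 * r) * (1 + r)) \<le> norm (u y) * ((3 * r) * (2 * r))"
        by (intro mult_left_mono) auto
      also have "\<dots> = 6 * (r * norm (u y)) * r" by simp
      also have "\<dots> \<le> 6 * C * r"
        using C(3)[of y] r by (intro mult_right_mono) (auto simp: r_def)
      finally show ?thesis .
    qed
    then show ?thesis unfolding r_def[symmetric] eq using p by (simp add: field_simps)
  qed
  then show ?thesis using C(1) by (intro exI[of _ "6 * C"]) auto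
qed

text \<open>Each coefficient \<open>1/k\<close> is replaced by \<open>1\<close>, and the bounds of the terms telescope to at most \<open>C\<close>.\<close>

lemma f_seq_bound:
  fixes u :: "'a::euclidean_space \<Rightarrow> complex"
  assumes u: "schwartz u" and u0: "u 0 = 0"
  shows "\<exists>C>0. \<forall>n x. Gamma_seq n \<ge> 0 \<longrightarrow> norm (f_seq u n x) \<le> C * Gamma_seq n"
proof -
  define h where "h = (\<lambda>r::real. r / (1 + r))"
  obtain C where C: "C > 0" and bound: "\<And>y. norm (u y) \<le> C * (h (2 * norm y) - h (norm y))"
    using schwartz_dyadic_difference_bound[OF u u0] unfolding h_def by blast
  have "norm (f_seq u n x) \<le> C * Gamma_seq n" if \<Gamma>: "Gamma_seq n \<ge> 0" for n x
  proof -
    have "norm (\<Sum>k=1..n. 1 / of_nat k * u (2 ^ k *\<^sub>R x)) \<le> (\<Sum>k=1..n. C * (h (2 ^ Suc k * norm x) - h (2 ^ k * norm x)))"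
    proof (rule sum_norm_le)
      fix k assume "k \<in> {1..n}"
      then have "norm (1 / of_nat k * u (2 ^ k *\<^sub>R x)) \<le> 1 * norm (u (2 ^ k *\<^sub>R x))"
        unfolding norm_mult by (intro mult_right_mono) (auto simp: norm_divide divide_le_eq)
      also have "\<dots> \<le> C * (h (2 ^ Suc k * norm x) - h (2 ^ k * norm x))"
        using bound[of "2 ^ k *\<^sub>R x"] by (simp add: mult.assoc)
      finally show "norm (1 / of_nat k * u (2 ^ k *\<^sub>R x)) \<le> C * (h (2 ^ Suc k * norm x) - h (2 ^ k * norm x))" .
    qed
    also have "\<dots> = C * (h (2 ^ Suc n * norm x) - h (2 ^ 1 * norm x))"
      unfolding sum_distrib_left[symmetric] by (subst sum_Suc_diff) auto
    also have "\<dots> \<le> C * (1 - 0)"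
      using C by (intro mult_left_mono diff_mono) (auto simp: h_def divide_le_eq add_pos_nonneg)
    finally show ?thesis
      using \<Gamma> mult_left_mono[of _ C "Gamma_seq n"] by (simp add: f_seq_def norm_mult mult.commute[of C])
  qed
  then show ?thesis using C by blast
qed

section \<open>Summation over the blocks\<close>

lemma ln_gt_1: "n \<ge> 3 \<Longrightarrow> ln (real n) > 1"
proof -
  assume n: "n \<ge> 3"
  have "exp 1 < (3::real)" using e_less_272 by simp
  also have "3 \<le> real n" using n by simp
  finally have "ln (exp 1) < ln (real n)" using n by (subst ln_less_cancel_iff) auto
  then show ?thesis by simp
qed

lemma Gamma_seq_pos: "n \<ge> 3 \<Longrightarrow> Gamma_seq n > 0"
  using ln_gt_1[of n] by (simp add: Gamma_seq_def)

lemma harm_le_2_ln: assumes "n \<ge> 3" shows "harm n \<le> 2 * ln (real n)"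
  using euler_mascheroni_sequence_decreasing[of 1 n] ln_gt_1[OF assms] assms by (simp add: harm_def)

lemma ln_self_le_harm: "ln (real n) \<le> harm n"
proof (cases "n = 0")
  case False
  then have "ln (real n) \<le> ln (real n + 1)" by simp
  also have "\<dots> \<le> harm n" by (rule ln_le_harm)
  finally show ?thesis .
qed (simp add: harm_def)

lemma block_coeff_nonneg: "n \<ge> 3 \<Longrightarrow> block_coeff n j \<ge> 0"
  using Gamma_seq_pos[of n] by (simp add: block_coeff_def)

lemma nn_integral_block_coeff:
  assumes n: "n \<ge> 3"
  shows "(\<integral>\<^sup>+j. ennreal (block_coeff n j) \<partial>count_space {-1..}) = ennreal (Gamma_seq n * harm n)"
proof -
  have "(\<integral>\<^sup>+j. ennreal (block_coeff n j) \<partial>count_space {-1..}) = (\<Sum>j\<in>{1..int n}. ennreal (block_coeff n j))"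
    by (rule nn_integral_count_space') (auto simp: block_coeff_def)
  also have "\<dots> = ennreal (\<Sum>j\<in>{1..int n}. block_coeff n j)"
    using block_coeff_nonneg[OF n] by (intro sum_ennreal) auto
  also have "{1..int n} = int ` {1..n}" by (simp add: image_int_atLeastAtMost)
  also have "(\<Sum>j\<in>int ` {1..n}. block_coeff n j) = (\<Sum>k\<in>{1..n}. block_coeff n (int k))"
    by (subst sum.reindex) auto
  also have "\<dots> = Gamma_seq n * harm n"
    by (simp add: block_coeff_def harm_def sum_distrib_left divide_inverse)
  finally show ?thesis .
qed

lemma besov_norm_l1:
  "besov_norm \<theta> s p 1 T = (\<integral>\<^sup>+j. ennreal (2 powr (real_of_int j * s)) * dist_Lp_norm p (lp_block \<theta> j T) \<partial>count_space {-1..})"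
  by (simp add: besov_norm_def eLp_norm_def enn_powr_1)

text \<open>The Besov weight at the critical exponent compensates the effect of the dilation on the \<open>L\<^sup>p\<close> norm. For negative
  \<open>j\<close>, where \<open>nat j\<close> is \<open>0\<close> and the weights do not cancel, both sides vanish with the coefficient.\<close>

lemma besov_weight_cancel:
  assumes "n \<ge> 3" and "c > 0"
  shows "ennreal (2 powr (real_of_int j * s)) * ennreal (c * block_coeff n j * (2 ^ nat j) powr (- s)) =
    ennreal c * ennreal (block_coeff n j)"
proof (cases "j \<ge> 0")
  case True
  have "2 ^ nat j = 2 powr (real_of_int j)"
    using True by (simp add: powr_realpow[symmetric])
  then have "2 powr (real_of_int j * s) * (2 ^ nat j) powr (- s) = 1"
    by (simp add: powr_powr powr_add[symmetric])
  then have "2 powr (real_of_int j * s) * (c * block_coeff n j * (2 ^ nat j) powr (- s)) = c * block_coeff n j"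
    by (metis mult.left_commute mult.right_neutral)
  then show ?thesis
    using assms block_coeff_nonneg[of n j] by (simp add: ennreal_mult[symmetric])
qed (simp add: block_coeff_def)

lemma ennreal_cmult_le_iff_div:
  fixes x y :: ennreal
  assumes c: "c > 0" and "ennreal c * x \<le> y"
  shows "x \<le> ennreal (1 / c) * y"
proof -
  have "x = ennreal (1 / c) * (ennreal c * x)"
    using c by (simp add: mult.assoc[symmetric] ennreal_mult[symmetric])
  also have "\<dots> \<le> ennreal (1 / c) * y"
    using assms by (intro mult_left_mono) auto
  finally show ?thesis .
qed

section \<open>The norms of the sequence\<close>

theorem proposition1p1:
  fixes \<theta> :: "real ^ 'd \<Rightarrow> real" and chi :: "real ^ 'd \<Rightarrow> complex"
  assumes "lp_cutoff \<theta>"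
    and "schwartz chi" and "chi \<noteq> (\<lambda>x. 0)" and "chi 0 = 0"
    and "closure {\<xi>. fourier chi \<xi> \<noteq> 0} \<subseteq> {\<xi>. 4/3 \<le> norm \<xi> \<and> norm \<xi> \<le> 3/2}"
  shows "(\<forall>p::ennreal. 1 \<le> p \<longrightarrow>
            (\<exists>C::real. C > 0 \<and> (\<forall>n\<ge>3.
               besov_norm \<theta> (critical_exponent CARD('d) p) p 1 (dist_of (f_seq chi n))
                 \<le> ennreal C * ennreal (Gamma_seq n * ln (real n)))) \<and>
            (\<exists>C::real. C > 0 \<and> (\<forall>n\<ge>3.
               ennreal (Gamma_seq n * ln (real n))
                 \<le> ennreal C *
                    besov_norm \<theta> (critical_exponent CARD('d) p) p 1 (dist_of (f_seq chi n))))) \<and>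
         (\<exists>C::real. C > 0 \<and> (\<forall>n\<ge>3. Lp_norm \<infinity> (f_seq chi n) \<le> ennreal (C * Gamma_seq n)))"
proof (intro conjI allI impI)
  note \<theta> = assms(1) and chi = assms(2) and nz = assms(3) and chi0 = assms(4)
  have int: "integrable lborel chi" by (rule schwartz_integrable[OF chi])
  then have [measurable]: "chi \<in> borel_measurable borel" by auto
  have supp: "4/3 \<le> norm \<eta> \<and> norm \<eta> \<le> 3/2" if "fourier chi \<eta> \<noteq> 0" for \<eta>
    using that subsetD[OF subset_trans[OF closure_subset assms(5)], of \<eta>] by simp
  define v where "v = (\<lambda>n j x. of_real (block_coeff n j) * chi (2 ^ nat j *\<^sub>R x))"
  have block: "lp_block \<theta> j (dist_of (f_seq chi n)) \<psi> = dist_of (v n j) \<psi>" if "schwartz \<psi>" for n j \<psi>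
    unfolding v_def
    by (rule lp_block_f_seq[OF \<theta> int schwartz_continuous[OF chi] schwartz_bounded[OF chi] supp schwartz_integrable[OF that]])
  have v: "integrable lborel (v n j)" for n j
    using lborel_integrable_affine[OF int, of "2 ^ nat j" 0] by (simp add: v_def)
  have rep: "represents (v n j) (lp_block \<theta> j (dist_of (f_seq chi n)))" for n j
    unfolding represents_def
    using borel_measurable_integrable[OF v] block integrable_mult_schwartz[OF v] by blast
  {
    fix p :: ennreal assume p: "1 \<le> p"
    let ?s = "critical_exponent CARD('d) p"
    have DIM: "critical_exponent DIM(real ^ 'd) p = ?s" by (simp only: DIM_cart DIM_real mult_1_right)
    let ?F = "\<lambda>n j. ennreal (2 powr (real_of_int j * ?s)) * dist_Lp_norm p (lp_block \<theta> j (dist_of (f_seq chi n)))"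
    obtain C where C: "C > 0" and up: "\<forall>s\<ge>0. \<forall>a>0.
        Lp_norm p (\<lambda>x. of_real s * chi (a *\<^sub>R x)) \<le> ennreal (C * s * a powr (- ?s))"
      using Lp_norm_dilation_le[OF int schwartz_bounded[OF chi] p] unfolding DIM
      by (elim exE conjE) (rule that)
    obtain c where c: "c > 0" and low: "\<forall>s\<ge>0. \<forall>a>0. \<forall>T g. represents g T \<longrightarrow>
        (\<forall>\<psi>. schwartz \<psi> \<longrightarrow> T \<psi> = dist_of (\<lambda>x. of_real s * chi (a *\<^sub>R x)) \<psi>) \<longrightarrow>
        ennreal (c * s * a powr (- ?s)) \<le> Lp_norm p g"
      using Lp_norm_ge_of_pairing[OF chi nz p] unfolding DIM
      by (elim exE conjE) (rule that)
    have F_le: "?F n j \<le> ennreal C * ennreal (block_coeff n j)" if n: "n \<ge> 3" for n j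
    proof -
      have "dist_Lp_norm p (lp_block \<theta> j (dist_of (f_seq chi n))) \<le> Lp_norm p (v n j)"
        unfolding dist_Lp_norm_def using rep by (intro INF_lower) auto
      also have "\<dots> \<le> ennreal (C * block_coeff n j * (2 ^ nat j) powr (- ?s))"
        unfolding v_def by (rule up[rule_format]) (use block_coeff_nonneg[OF n] in auto)
      finally have "?F n j \<le> ennreal (2 powr (real_of_int j * ?s)) * ennreal (C * block_coeff n j * (2 ^ nat j) powr (- ?s))"
        by (intro mult_left_mono) auto
      then show ?thesis by (simp only: besov_weight_cancel[OF n C])
    qed
    \<comment> \<open>every representing function of the block has to be bounded below, not just \<open>v n j\<close>\<close>
    have F_ge: "ennreal c * ennreal (block_coeff n j) \<le> ?F n j" if n: "n \<ge> 3" for n j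
    proof -
      have "ennreal (c * block_coeff n j * (2 ^ nat j) powr (- ?s)) \<le> dist_Lp_norm p (lp_block \<theta> j (dist_of (f_seq chi n)))"
        unfolding dist_Lp_norm_def
      proof (rule INF_greatest)
        fix g assume "g \<in> {g. represents g (lp_block \<theta> j (dist_of (f_seq chi n)))}"
        then show "ennreal (c * block_coeff n j * (2 ^ nat j) powr (- ?s)) \<le> Lp_norm p g"
          using block[of _ j n] block_coeff_nonneg[OF n, of j] unfolding v_def
          by (intro low[rule_format, where T = "lp_block \<theta> j (dist_of (f_seq chi n))"]) auto
      qed
      then have "ennreal (2 powr (real_of_int j * ?s)) * ennreal (c * block_coeff n j * (2 ^ nat j) powr (- ?s)) \<le> ?F n j"
        by (intro mult_left_mono) auto
      then show ?thesis by (simp only: besov_weight_cancel[OF n c])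
    qed
    have "besov_norm \<theta> ?s p 1 (dist_of (f_seq chi n)) \<le> ennreal (2 * C) * ennreal (Gamma_seq n * ln (real n))"
      if n: "n \<ge> 3" for n
    proof -
      have "besov_norm \<theta> ?s p 1 (dist_of (f_seq chi n)) \<le> (\<integral>\<^sup>+j. ennreal C * ennreal (block_coeff n j) \<partial>count_space {-1..})"
        unfolding besov_norm_l1 by (intro nn_integral_mono F_le n)
      also have "\<dots> = ennreal C * ennreal (Gamma_seq n * harm n)"
        by (simp add: nn_integral_cmult nn_integral_block_coeff[OF n])
      also have "\<dots> \<le> ennreal C * ennreal (Gamma_seq n * (2 * ln (real n)))"
        using Gamma_seq_pos[OF n] harm_le_2_ln[OF n] by (intro mult_left_mono ennreal_leI) auto
      also have "\<dots> = ennreal (2 * C) * ennreal (Gamma_seq n * ln (real n))"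
        using C Gamma_seq_pos[OF n] ln_gt_1[OF n] by (simp add: ennreal_mult[symmetric] mult_ac)
      finally show ?thesis .
    qed
    then show "\<exists>C>0. \<forall>n\<ge>3. besov_norm \<theta> ?s p 1 (dist_of (f_seq chi n)) \<le> ennreal C * ennreal (Gamma_seq n * ln (real n))"
      using C by (intro exI[of _ "2 * C"]) auto
    have "ennreal (Gamma_seq n * ln (real n)) \<le> ennreal (1 / c) * besov_norm \<theta> ?s p 1 (dist_of (f_seq chi n))"
      if n: "n \<ge> 3" for n
    proof (rule ennreal_cmult_le_iff_div[OF c])
      have "ennreal c * ennreal (Gamma_seq n * ln (real n)) \<le> ennreal c * ennreal (Gamma_seq n * harm n)"
        using Gamma_seq_pos[OF n] ln_self_le_harm[of n] by (intro mult_left_mono ennreal_leI) auto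
      also have "\<dots> = (\<integral>\<^sup>+j. ennreal c * ennreal (block_coeff n j) \<partial>count_space {-1..})"
        by (simp add: nn_integral_cmult nn_integral_block_coeff[OF n])
      also have "\<dots> \<le> besov_norm \<theta> ?s p 1 (dist_of (f_seq chi n))"
        unfolding besov_norm_l1 by (intro nn_integral_mono F_ge n)
      finally show "ennreal c * ennreal (Gamma_seq n * ln (real n)) \<le> besov_norm \<theta> ?s p 1 (dist_of (f_seq chi n))" .
    qed
    then show "\<exists>C>0. \<forall>n\<ge>3. ennreal (Gamma_seq n * ln (real n)) \<le> ennreal C * besov_norm \<theta> ?s p 1 (dist_of (f_seq chi n))"
      using c by (intro exI[of _ "1 / c"]) auto
  }
  obtain C where C: "C > 0" and bound: "\<And>n x. Gamma_seq n \<ge> 0 \<Longrightarrow> norm (f_seq chi n x) \<le> C * Gamma_seq n"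
    using f_seq_bound[OF chi chi0] by blast
  have [measurable]: "f_seq chi n \<in> borel_measurable borel" for n
    unfolding f_seq_def by measurable
  have "Lp_norm \<infinity> (f_seq chi n) \<le> ennreal (C * Gamma_seq n)" if "n \<ge> 3" for n
    unfolding Lp_norm_def eLp_norm_def using Gamma_seq_pos[OF that] bound[of n]
    by (auto intro!: esssup_I AE_I2 ennreal_leI)
  then show "\<exists>C>0. \<forall>n\<ge>3. Lp_norm \<infinity> (f_seq chi n) \<le> ennreal (C * Gamma_seq n)"
    using C by blast
qed

end
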